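(* Let $H\in C^2(\mathbb{R}^2;\mathbb{R})$ be radially symmetric, $H(p)=h(|p|)$, with $$h(s)=1+\frac{A}{s^\gamma}+\frac{\tilde h(s)}{s^{\gamma+\beta}}\quad\text{for all sufficiently large } s,$$ where $A\in\mathbb{R}\setminus\{0\}$, $\gamma>1$, $\beta\ge0$ and $\tilde h\in C^2((0,+\infty);\mathbb{R})$ satisfies: if $\beta>1$, $\tilde h$ is bounded; if $\beta\in(0,1]$, $\tilde h(s)=B+o(s^{\beta-1})$ as $s\to\infty$ for some $B\in\mathbb{R}$; if $\beta=0$, $\tilde h(s)=B+o(s^{-1})$ as $s\to\infty$ for some $B\neq-A$. Assume moreover that there is $C>0$ with $|h''(s)|\le C s^{-(\gamma+1+\min\{1,\beta\})}$ for all large $s$. Then there exist infinitely many closed immersed curves of class $C^{2,\alpha}$ ($\alpha\in(0,1)$) whose curvature coincides with $H$ at every point.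
   Context: For a regular parametrization $U$ of a planar curve (identifying $\mathbb{R}^2$ with $\mathbb{C}$, $ip$ = rotation of $p$ by $\pi/2$), its curvature is $\mathcal{K}(U)=\frac{i\dot U\cdot\ddot U}{|\dot U|^3}$; "curvature coincides with $H$" means $\mathcal{K}(U)(t)=H(U(t))$ for all $t$. *)

theory Defs
  imports "HOL-Analysis.Analysis" "HOL-Library.Landau_Symbols"
begin

definition C2_plane :: "(complex \<Rightarrow> real) \<Rightarrow> bool" where
  "C2_plane H \<longleftrightarrow>
     (\<exists>(H1 :: complex \<Rightarrow> complex \<Rightarrow>\<^sub>L real) (H2 :: complex \<Rightarrow> complex \<Rightarrow>\<^sub>L (complex \<Rightarrow>\<^sub>L real)).
        (\<forall>p. (H has_derivative blinfun_apply (H1 p)) (at p)) \<and>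
        (\<forall>p. (H1 has_derivative blinfun_apply (H2 p)) (at p)) \<and>
        continuous_on UNIV H2)"

definition C2_pos :: "(real \<Rightarrow> real) \<Rightarrow> bool" where
  "C2_pos f \<longleftrightarrow>
     (\<exists>f1 f2. (\<forall>s>0. (f has_real_derivative f1 s) (at s) \<and> (f1 has_real_derivative f2 s) (at s))
              \<and> continuous_on {0<..} f2)"

definition curvature :: "complex \<Rightarrow> complex \<Rightarrow> real" where
  "curvature U1 U2 = inner (\<i> * U1) U2 / (cmod U1) ^ 3"

definition closed_curve_C2a_curv :: "real \<Rightarrow> (complex \<Rightarrow> real) \<Rightarrow> (real \<Rightarrow> complex) \<Rightarrow> bool" where
  "closed_curve_C2a_curv \<alpha> H U \<longleftrightarrow>
     (\<exists>T>0. \<forall>t. U (t + T) = U t) \<and>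
     (\<exists>U1 U2.
        (\<forall>t. (U has_vector_derivative U1 t) (at t)) \<and>
        (\<forall>t. (U1 has_vector_derivative U2 t) (at t)) \<and>
        continuous_on UNIV U2 \<and>
        (\<exists>K. \<forall>s t. cmod (U2 s - U2 t) \<le> K * \<bar>s - t\<bar> powr \<alpha>) \<and>
        (\<forall>t. U1 t \<noteq> 0) \<and>
        (\<forall>t. curvature (U1 t) (U2 t) = H (U t)))"

end

theory Submission
  imports Defs
begin

text \<open>
  For a curve \<open>U\<close> with unit tangent \<open>e\<^sup>i\<^sup>\<theta>\<close> and curvature \<open>h(|U|)\<close>, the quantity \<open>iU' \<bullet> U + G(|U|)\<close> with
  \<open>G'(s) = s h(s)\<close> is a first integral. Writing \<open>U = r e\<^sup>i\<^sup>\<phi>\<close> and using \<open>t = \<theta> - \<phi>\<close> as parameter, it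
  becomes the algebraic equation \<open>G(r) - r sin t = M\<^sup>2/2\<close>, which for large \<open>M\<close> determines \<open>r\<close> as a
  function of \<open>sin t\<close>; then \<open>\<phi>' = sin t / (r h(r) - sin t)\<close>, so the whole curve is obtained by a
  quadrature, without solving an ODE. The curve closes up iff the angle \<open>\<Delta>(M)\<close> gained over one period
  is a rational multiple of \<open>2\<pi>\<close>. Pairing \<open>sin t\<close> with \<open>- sin t\<close> gives
  \<open>M\<^bsup>\<gamma>+2\<^esup> \<Delta>(M) \<longlongrightarrow> a\<gamma>\<pi>\<close> for \<open>h(s) = 1 + a s\<^bsup>-\<gamma>\<^esup> + \<dots>\<close>, so \<open>\<Delta>\<close> is continuous, eventually nonzero and
  tends to \<open>0\<close>: it attains \<open>2\<pi>/n\<close> or \<open>-2\<pi>/n\<close> for all large \<open>n\<close>. The largest distance from the origin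
  determines \<open>M\<close>, so different \<open>M\<close> give curves that no rotation identifies.
\<close>

subsection \<open>Periodic functions\<close>

lemma abs_sin_le_two: "\<bar>sin t\<bar> \<le> (2::real)"
  using abs_sin_le_one[of t] by linarith

lemma has_integral_sin_squared: "((\<lambda>t::real. (sin t)\<^sup>2) has_integral pi) {-pi..pi}"
proof -
  have "((\<lambda>t::real. (t - sin t * cos t) / 2) has_real_derivative (sin t)\<^sup>2) (at t)" for t
    by (auto intro!: derivative_eq_intros simp: power2_eq_square field_simps)
       (use sin_cos_squared_add3[of t] in algebra)
  then have "((\<lambda>t. (sin t)\<^sup>2) has_integral ((pi - sin pi * cos pi) / 2 - (-pi - sin (-pi) * cos (-pi)) / 2)) {-pi..pi}"
    by (intro fundamental_theorem_of_calculus)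
       (auto intro: has_vector_derivative_at_within simp: has_real_derivative_iff_has_vector_derivative)
  then show ?thesis by simp
qed

lemma continuous_periodic_bounded:
  fixes f :: "real \<Rightarrow> 'a::real_normed_vector"
  assumes cont: "continuous_on UNIV f" and "T > 0" and per: "\<And>t. f (t + T) = f t"
  obtains B where "\<And>t. norm (f t) \<le> B"
proof -
  have "compact (f ` {0..T})"
    by (intro compact_continuous_image continuous_on_subset[OF cont]) auto
  then obtain B where B: "\<And>t. t \<in> {0..T} \<Longrightarrow> norm (f t) \<le> B"
    using compact_imp_bounded[of "f ` {0..T}"] unfolding bounded_iff by blast
  interpret f: periodic_fun_simple f T
    by unfold_locales (rule per)
  have "norm (f t) \<le> B" for t
  proof -
    define k where "k = \<lfloor>t / T\<rfloor>"
    have "of_int k \<le> t / T" "t / T < of_int k + 1"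
      unfolding k_def by linarith+
    then have "of_int k * T \<le> t" "t < (of_int k + 1) * T"
      using \<open>T > 0\<close> by (auto simp: field_simps)
    then have "t + of_int (-k) * T \<in> {0..T}"
      by (auto simp: algebra_simps)
    from B[OF this] show ?thesis using f.plus_of_int[of t "-k"] by simp
  qed
  then show ?thesis using that by blast
qed

lemma vector_derivative_periodic:
  fixes f f' :: "real \<Rightarrow> 'a::real_normed_vector"
  assumes deriv: "\<And>t. (f has_vector_derivative f' t) (at t)" and per: "\<And>t. f (t + T) = f t"
  shows "f' (t + T) = f' t"
proof -
  have "((\<lambda>t. f (t + T)) has_vector_derivative 1 *\<^sub>R f' (t + T)) (at t)"
    by (rule vector_diff_chain_at[of "\<lambda>t. t + T" 1 t f, unfolded o_def])
       (auto intro!: derivative_eq_intros deriv)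
  then show ?thesis
    using vector_derivative_unique_at[OF deriv[of t]] by (simp add: per)
qed

text \<open>Periodicity bounds both \<open>f\<close> and \<open>f'\<close>. So \<open>f\<close> is
  Lipschitz, which settles |s - t| \<le> 1, and bounded, which settles larger distances.\<close>

lemma C1_periodic_Hoelder:
  fixes f f' :: "real \<Rightarrow> 'a::real_normed_vector"
  assumes deriv: "\<And>t. (f has_vector_derivative f' t) (at t)"
    and cont: "continuous_on UNIV f'"
    and "T > 0" and per: "\<And>t. f (t + T) = f t"
    and \<alpha>: "0 < \<alpha>" "\<alpha> < 1"
  shows "\<exists>K. \<forall>s t. norm (f s - f t) \<le> K * \<bar>s - t\<bar> powr \<alpha>"
proof -
  have per': "f' (t + T) = f' t" for t
    by (rule vector_derivative_periodic[OF deriv per])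
  obtain B where B: "norm (f t) \<le> B" for t
    by (rule continuous_periodic_bounded[where f = f, OF _ \<open>T > 0\<close> per])
       (auto intro!: continuous_at_imp_continuous_on has_vector_derivative_continuous[OF deriv])
  obtain L where L: "norm (f' t) \<le> L" for t
    by (rule continuous_periodic_bounded[where f = f', OF cont \<open>T > 0\<close> per']) blast
  have "B \<ge> 0" "L \<ge> 0" using B[of 0] L[of 0] norm_ge_zero order_trans by blast+
  have lip: "norm (f s - f t) \<le> L * \<bar>s - t\<bar>" for s t
    using differentiable_bound[of UNIV f "\<lambda>t d. d *\<^sub>R f' t" L s t] deriv L
    by (simp add: has_vector_derivative_def onorm_scaleR_left bounded_linear_ident onorm_id)
  have "norm (f s - f t) \<le> (L + 2 * B) * \<bar>s - t\<bar> powr \<alpha>" for s t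
  proof (cases "\<bar>s - t\<bar> \<le> 1")
    case True
    have "\<bar>s - t\<bar> \<le> \<bar>s - t\<bar> powr \<alpha>"
      using powr_mono'[of \<alpha> 1 "\<bar>s - t\<bar>"] True \<alpha> by simp
    then have "L * \<bar>s - t\<bar> \<le> L * \<bar>s - t\<bar> powr \<alpha>"
      using \<open>L \<ge> 0\<close> by (rule mult_left_mono)
    moreover have "0 \<le> 2 * B * \<bar>s - t\<bar> powr \<alpha>" using \<open>B \<ge> 0\<close> by simp
    ultimately show ?thesis using lip[of s t] by (simp add: distrib_right)
  next
    case False
    have "norm (f s - f t) \<le> 2 * B"
      using norm_triangle_ineq4[of "f s" "f t"] B[of s] B[of t] by simp
    moreover have "2 * B * 1 \<le> 2 * B * \<bar>s - t\<bar> powr \<alpha>"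
      using False \<alpha> \<open>B \<ge> 0\<close> by (intro mult_left_mono ge_one_powr_ge_zero) auto
    moreover have "0 \<le> L * \<bar>s - t\<bar> powr \<alpha>" using \<open>L \<ge> 0\<close> by simp
    ultimately show ?thesis by (simp add: distrib_right)
  qed
  then show ?thesis by blast
qed

subsection \<open>Curves on a level of the first integral\<close>

text \<open>The constant 3 makes the slope \<open>s * h s - \<sigma>\<close> of the level function
  at least 1 for all \<sigma> \<le> 2. Allowing |\<sigma>| up to 2 keeps the extreme values of the
  sine in the interior, so that two-sided derivatives exist there. The condition on
  \<open>M0\<close> puts \<open>G R - R * \<sigma>\<close> below every level M^2/2 with M \<ge>
  \<open>M0\<close>.\<close>

locale radial_curvature =
  fixes h h1 h2 G :: "real \<Rightarrow> real" and R M0 :: real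
  assumes dh: "\<And>s. s > 0 \<Longrightarrow> (h has_real_derivative h1 s) (at s)"
    and dh1: "\<And>s. s > 0 \<Longrightarrow> (h1 has_real_derivative h2 s) (at s)"
    and cont_h2: "continuous_on {0<..} h2"
    and dG: "\<And>s. s > 0 \<Longrightarrow> (G has_real_derivative s * h s) (at s)"
    and R_pos: "R > 0" and R: "\<And>s. s \<ge> R \<Longrightarrow> s * h s \<ge> 3"
    and M0_pos: "M0 > 0" and M0: "G R + 2 * R \<le> M0\<^sup>2 / 2"
begin

section \<open>Radius as a function of the level and the sine\<close>

text \<open>This solves the first integral for the distance to the origin, with \<sigma> in place of
  sin t. The level is written M^2/2 because the radius then grows like M; r \<ge> R selects the
  range on which the level function increases.\<close>

definition level_radius :: "real \<Rightarrow> real \<Rightarrow> real" where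
  "level_radius M \<sigma> = (THE r. r \<ge> R \<and> G r - r * \<sigma> = M\<^sup>2 / 2)"

text \<open>The derivative in r is \<open>r * h r - \<sigma>\<close>, at least 3 - 2. This
  quantitative monotonicity yields uniqueness, existence and stability of the radius.\<close>

lemma level_growth:
  assumes "R \<le> x" "x \<le> y" "\<sigma> \<le> 2"
  shows "y - x \<le> (G y - y * \<sigma>) - (G x - x * \<sigma>)"
proof -
  have "G x - x * \<sigma> - x \<le> G y - y * \<sigma> - y"
  proof (rule DERIV_nonneg_imp_nondecreasing[OF \<open>x \<le> y\<close>], goal_cases)
    case (1 t)
    then have "t \<ge> R" "t > 0" using assms R_pos by auto
    then show ?case using R[of t] \<open>\<sigma> \<le> 2\<close> 
      by (intro exI[of _ "t * h t - \<sigma> - 1"]) (auto intro!: derivative_eq_intros dG)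
  qed
  then show ?thesis by simp
qed

lemma level_radius_unique:
  assumes "r \<ge> R" "G r - r * \<sigma> = M\<^sup>2 / 2" "\<sigma> \<le> 2"
  shows "level_radius M \<sigma> = r"
  unfolding level_radius_def
proof (rule the_equality)
  fix x assume x: "R \<le> x \<and> G x - x * \<sigma> = M\<^sup>2 / 2"
  show "x = r"
    using level_growth[of x r \<sigma>] level_growth[of r x \<sigma>] x assms by linarith
qed (use assms in auto)

lemma level_radius:
  assumes "M \<ge> M0" "\<bar>\<sigma>\<bar> \<le> 2"
  shows "level_radius M \<sigma> \<ge> R"
    and "G (level_radius M \<sigma>) - level_radius M \<sigma> * \<sigma> = M\<^sup>2 / 2"
proof -
  have "M0\<^sup>2 \<le> M\<^sup>2" using M0_pos assms by (intro power_mono) auto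
  moreover have "R * (-\<sigma>) \<le> R * 2" using R_pos assms by (intro mult_left_mono) auto
  ultimately have lo: "G R - R * \<sigma> \<le> M\<^sup>2 / 2"
    using M0 by simp
  \<comment> \<open>Growth at rate at least 1 from \<open>R\<close> onwards lifts the level function
    to M^2/2 by the time \<open>y\<close> is reached.\<close>
  define y where "y = R + (M\<^sup>2 / 2 - (G R - R * \<sigma>))"
  have "y \<ge> R" using lo by (simp add: y_def)
  have hi: "M\<^sup>2 / 2 \<le> G y - y * \<sigma>"
    using level_growth[of R y \<sigma>] \<open>y \<ge> R\<close> assms by (simp add: y_def)
  have "continuous_on {R..y} (\<lambda>r. G r - r * \<sigma>)"
    using R_pos by (intro continuous_at_imp_continuous_on ballI continuous_intros DERIV_isCont[OF dG]) auto
  then obtain r where "r \<ge> R" "G r - r * \<sigma> = M\<^sup>2 / 2"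
    using IVT'[of "\<lambda>r. G r - r * \<sigma>" R "M\<^sup>2/2" y] lo hi \<open>y \<ge> R\<close> by auto
  then show "level_radius M \<sigma> \<ge> R"
    "G (level_radius M \<sigma>) - level_radius M \<sigma> * \<sigma> = M\<^sup>2 / 2"
    using level_radius_unique assms by auto
qed

lemma level_radius_pos: "M \<ge> M0 \<Longrightarrow> \<bar>\<sigma>\<bar> \<le> 2 \<Longrightarrow> level_radius M \<sigma> > 0"
  using level_radius(1)[of M \<sigma>] R_pos by linarith

lemma level_slope_pos:
  assumes "M \<ge> M0" "\<bar>\<sigma>\<bar> \<le> 2"
  shows "level_radius M \<sigma> * h (level_radius M \<sigma>) - \<sigma> \<ge> 1"
  using R[OF level_radius(1)[OF assms]] assms by linarith

text \<open>The level function with parameter \<sigma>' takes values at the two radii that differ by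
  an explicit amount; by \<open>level_growth\<close> this amount bounds the distance of the
  radii.\<close>

lemma level_radius_stability:
  assumes M: "M \<ge> M0" "\<bar>\<sigma>\<bar> \<le> 2" and N: "N \<ge> M0" "\<bar>\<sigma>'\<bar> \<le> 2"
  shows "\<bar>level_radius N \<sigma>' - level_radius M \<sigma>\<bar>
    \<le> \<bar>N\<^sup>2 - M\<^sup>2\<bar> / 2 + level_radius M \<sigma> * \<bar>\<sigma>' - \<sigma>\<bar>"
proof -
  let ?r = "level_radius M \<sigma>" and ?r' = "level_radius N \<sigma>'"
  have e: "(G ?r' - ?r' * \<sigma>') - (G ?r - ?r * \<sigma>') = (N\<^sup>2 - M\<^sup>2) / 2 + ?r * (\<sigma>' - \<sigma>)"
    using level_radius(2)[OF M] level_radius(2)[OF N] by (simp add: field_simps)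
  have "\<bar>?r' - ?r\<bar> \<le> \<bar>(N\<^sup>2 - M\<^sup>2) / 2 + ?r * (\<sigma>' - \<sigma>)\<bar>"
    using level_growth[of ?r ?r' \<sigma>'] level_growth[of ?r' ?r \<sigma>']
      level_radius(1)[OF M] level_radius(1)[OF N] N e by linarith
  also have "\<dots> \<le> \<bar>N\<^sup>2 - M\<^sup>2\<bar> / 2 + \<bar>?r * (\<sigma>' - \<sigma>)\<bar>"
    by (rule order.trans[OF abs_triangle_ineq]) simp
  also have "\<bar>?r * (\<sigma>' - \<sigma>)\<bar> = ?r * \<bar>\<sigma>' - \<sigma>\<bar>"
    using level_radius_pos[OF M] by (simp add: abs_mult)
  finally show ?thesis .
qed

text \<open>Squeezed by the stability bound, whose right side vanishes at the base point. Joint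
  continuity is what later makes the rotation angle continuous in M.\<close>

lemma continuous_on_level_radius:
  "continuous_on ({M0..} \<times> {-2..2}) (\<lambda>(M, \<sigma>). level_radius M \<sigma>)"
  unfolding continuous_on_def
proof
  fix z :: "real \<times> real"
  assume "z \<in> {M0..} \<times> {-2..2}"
  then obtain M \<sigma> where z: "z = (M, \<sigma>)" and M: "M \<in> {M0..}" "\<sigma> \<in> {-2..2}"
    by auto
  let ?F = "at (M, \<sigma>) within {M0..} \<times> {-2..2}"
  have "((\<lambda>z. \<bar>(fst z)\<^sup>2 - M\<^sup>2\<bar> / 2 + level_radius M \<sigma> * \<bar>snd z - \<sigma>\<bar>)
      \<longlongrightarrow> \<bar>(fst (M, \<sigma>))\<^sup>2 - M\<^sup>2\<bar> / 2 + level_radius M \<sigma> * \<bar>snd (M, \<sigma>) - \<sigma>\<bar>) ?F"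
    by (intro tendsto_intros) simp_all
  then have lim: "((\<lambda>z. \<bar>(fst z)\<^sup>2 - M\<^sup>2\<bar> / 2 + level_radius M \<sigma> * \<bar>snd z - \<sigma>\<bar>) \<longlongrightarrow> 0) ?F"
    by simp
  have "\<forall>\<^sub>F z in ?F. norm (level_radius (fst z) (snd z) - level_radius M \<sigma>)
      \<le> \<bar>(fst z)\<^sup>2 - M\<^sup>2\<bar> / 2 + level_radius M \<sigma> * \<bar>snd z - \<sigma>\<bar>"
    unfolding eventually_at_topological
    using M by (intro exI[of _ UNIV]) (auto intro!: level_radius_stability)
  then have "((\<lambda>z. level_radius (fst z) (snd z) - level_radius M \<sigma>) \<longlongrightarrow> 0) ?F"
    by (rule Lim_null_comparison[OF _ lim])
  then have "((\<lambda>z. level_radius (fst z) (snd z)) \<longlongrightarrow> level_radius M \<sigma>) ?F"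
    by (rule LIM_zero_cancel)
  then show "((\<lambda>(M, \<sigma>). level_radius M \<sigma>) \<longlongrightarrow> (case z of (M, \<sigma>) \<Rightarrow> level_radius M \<sigma>))
      (at z within {M0..} \<times> {-2..2})"
    by (simp add: case_prod_unfold z)
qed

text \<open>The level equation is linear in \<sigma>, so (G r - M^2/2)/r recovers \<sigma> from the
  radius; the derivative is the reciprocal of the derivative of this explicit inverse.\<close>

lemma DERIV_level_radius:
  assumes "M \<ge> M0" "\<bar>\<sigma>\<bar> < 2"
  shows "(level_radius M has_real_derivative
      level_radius M \<sigma> / (level_radius M \<sigma> * h (level_radius M \<sigma>) - \<sigma>)) (at \<sigma>)"
proof -
  let ?r = "level_radius M \<sigma>"
  have r: "?r > 0" and s: "?r * h ?r - \<sigma> \<ge> 1" and e: "G ?r - ?r * \<sigma> = M\<^sup>2 / 2"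
    using level_radius_pos[of M \<sigma>] level_slope_pos[of M \<sigma>] level_radius(2)[of M \<sigma>] assms by auto
  have "((\<lambda>r. (G r - M\<^sup>2 / 2) / r) has_real_derivative (?r * h ?r - \<sigma>) / ?r) (at ?r)"
  proof (rule DERIV_cong)
    show "((\<lambda>r. (G r - M\<^sup>2 / 2) / r) has_real_derivative
        ((?r * h ?r - 0) * ?r - (G ?r - M\<^sup>2 / 2) * 1) / (?r * ?r)) (at ?r)"
      using r by (intro DERIV_divide DERIV_diff dG DERIV_const DERIV_ident) auto
  qed (use r in \<open>simp add: e[symmetric] field_simps\<close>)
  moreover have "(G (level_radius M y) - M\<^sup>2 / 2) / level_radius M y = y" if "-2 < y" "y < 2" for y
  proof -
    have "\<bar>y\<bar> \<le> 2" using that by linarith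
    then show ?thesis
      using level_radius(2)[of M y] level_radius_pos[of M y] assms by (simp add: field_simps)
  qed
  moreover have "isCont (level_radius M) \<sigma>"
  proof -
    have "continuous_on {-2..2} (\<lambda>\<sigma>. (\<lambda>(M, \<sigma>). level_radius M \<sigma>) (M, \<sigma>))"
      using assms by (intro continuous_on_compose2[OF continuous_on_level_radius] continuous_intros) auto
    then have "continuous_on {-2<..<2} (level_radius M)"
      by (auto elim: continuous_on_subset)
    then show ?thesis
      using assms by (simp add: continuous_on_eq_continuous_at abs_less_iff)
  qed
  ultimately have "(level_radius M has_real_derivative inverse ((?r * h ?r - \<sigma>) / ?r)) (at \<sigma>)"
    using r s assms
    by (intro DERIV_inverse_function[where f = "\<lambda>r. (G r - M\<^sup>2 / 2) / r" and a = "-2" and b = 2])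
       (auto simp: abs_less_iff)
  then show ?thesis by (simp add: inverse_eq_divide)
qed

section \<open>Rate and total gain of the polar angle\<close>

definition turn_rate :: "real \<Rightarrow> real \<Rightarrow> real" where
  "turn_rate M \<sigma> = \<sigma> / (level_radius M \<sigma> * h (level_radius M \<sigma>) - \<sigma>)"

text \<open>This is \<Delta>(M). The interval is symmetric about 0 so that t can be paired with
  -t.\<close>

definition rotation_angle :: "real \<Rightarrow> real" where
  "rotation_angle M = integral {-pi..pi} (\<lambda>t. turn_rate M (sin t))"

lemma continuous_on_h: "continuous_on {0<..} h"
  by (auto intro!: continuous_at_imp_continuous_on DERIV_isCont dh)

lemma continuous_on_turn_rate:
  "continuous_on ({M0..} \<times> {-1..1}) (\<lambda>(M, \<sigma>). turn_rate M \<sigma>)"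
proof -
  have r: "continuous_on ({M0..} \<times> {-1..1}) (\<lambda>z. level_radius (fst z) (snd z))"
    using continuous_on_subset[OF continuous_on_level_radius, of "{M0..} \<times> {-1..1}"]
    by (force simp: case_prod_unfold)
  have "continuous_on ({M0..} \<times> {-1..1}) (\<lambda>z. h (level_radius (fst z) (snd z)))"
    by (rule continuous_on_compose2[OF continuous_on_h r]) (auto intro!: level_radius_pos)
  moreover have "level_radius M \<sigma> * h (level_radius M \<sigma>) - \<sigma> \<noteq> 0" if "M \<ge> M0" "\<bar>\<sigma>\<bar> \<le> 1" for M \<sigma>
    using level_slope_pos[of M \<sigma>] that by auto
  ultimately have "continuous_on ({M0..} \<times> {-1..1}) (\<lambda>z. turn_rate (fst z) (snd z))"
    unfolding turn_rate_def using r by (intro continuous_intros) auto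
  then show ?thesis by (simp add: case_prod_unfold)
qed

lemma continuous_on_turn_rate_sin:
  "continuous_on ({M0..} \<times> UNIV) (\<lambda>(M, t). turn_rate M (sin t))"
proof -
  have "continuous_on ({M0..} \<times> UNIV) (\<lambda>z. (\<lambda>(M, \<sigma>). turn_rate M \<sigma>) (fst z, sin (snd z)))"
    by (intro continuous_on_compose2[OF continuous_on_turn_rate] continuous_intros) auto
  then show ?thesis by (simp add: case_prod_unfold)
qed

lemma continuous_on_rotation_angle: "continuous_on {M0..} rotation_angle"
  unfolding rotation_angle_def
  using integral_continuous_on_param[of "{M0..}" "-pi" pi "\<lambda>M t. turn_rate M (sin t)"]
    continuous_on_subset[OF continuous_on_turn_rate_sin, of "{M0..} \<times> cbox (-pi) pi"]
  by auto

lemma turn_rate_sin_continuous: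
  assumes "M \<ge> M0"
  shows "continuous_on UNIV (\<lambda>t. turn_rate M (sin t))"
proof -
  have "continuous_on UNIV (\<lambda>t. (\<lambda>(M, t). turn_rate M (sin t)) (M, t))"
    using assms by (intro continuous_on_compose2[OF continuous_on_turn_rate_sin] continuous_intros) auto
  then show ?thesis by simp
qed

text \<open>Any antiderivative serves: the free constant only rotates the curve about the
  origin.\<close>

definition polar_angle :: "real \<Rightarrow> real \<Rightarrow> real" where
  "polar_angle M = (SOME \<phi>. \<forall>t. (\<phi> has_real_derivative turn_rate M (sin t)) (at t))"

lemma DERIV_polar_angle:
  assumes "M \<ge> M0"
  shows "(polar_angle M has_real_derivative turn_rate M (sin t)) (at t)"
proof -
  have "\<exists>\<phi>. \<forall>t::real. - \<infinity> < ereal t \<longrightarrow> ereal t < \<infinity> \<longrightarrow>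
      (\<phi> has_vector_derivative turn_rate M (sin t)) (at t)"
    using turn_rate_sin_continuous[OF assms]
    by (intro einterval_antiderivative) (auto simp: continuous_on_eq_continuous_at)
  then have "\<exists>\<phi>. \<forall>t. (\<phi> has_real_derivative turn_rate M (sin t)) (at t)"
    by (auto simp: has_real_derivative_iff_has_vector_derivative)
  from someI_ex[OF this] show ?thesis by (simp add: polar_angle_def)
qed

text \<open>The gain over one period has derivative 0, because the sine is periodic; evaluated at
  -pi it is the defining integral.\<close>

lemma polar_angle_period:
  assumes "M \<ge> M0"
  shows "polar_angle M (t + 2 * pi) = polar_angle M t + rotation_angle M"
proof -
  note d = DERIV_polar_angle[OF assms]
  have "((\<lambda>t. polar_angle M (t + 2 * pi) - polar_angle M t) has_real_derivative 0) (at t)" for t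
  proof -
    have "((\<lambda>t. polar_angle M (t + 2 * pi)) has_real_derivative turn_rate M (sin (t + 2*pi)) * 1) (at t)"
      by (rule DERIV_chain2[OF d]) (auto intro!: derivative_eq_intros)
    from DERIV_diff[OF this d[of t]] show ?thesis by simp
  qed
  then have "polar_angle M (t + 2 * pi) - polar_angle M t
      = polar_angle M (-pi + 2 * pi) - polar_angle M (-pi)"
    using DERIV_isconst_all[of "\<lambda>t. polar_angle M (t + 2 * pi) - polar_angle M t"] by blast
  moreover have "((\<lambda>t. turn_rate M (sin t)) has_integral (polar_angle M pi - polar_angle M (-pi))) {-pi..pi}"
    by (rule fundamental_theorem_of_calculus)
       (auto intro!: has_vector_derivative_at_within
          d[unfolded has_real_derivative_iff_has_vector_derivative])
  ultimately show ?thesis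
    by (auto simp: rotation_angle_def dest: integral_unique)
qed

section \<open>The curves, their congruence and their curvature\<close>

definition level_curve :: "real \<Rightarrow> real \<Rightarrow> complex" where
  "level_curve M t = of_real (level_radius M (sin t)) * cis (polar_angle M t)"

lemma norm_level_curve: "M \<ge> M0 \<Longrightarrow> norm (level_curve M t) = level_radius M (sin t)"
  using level_radius_pos[of M "sin t"] by (simp add: level_curve_def norm_mult abs_sin_le_two)

text \<open>The radius repeats while the polar angle gains \<Delta>(M) each period, so n periods
  amount to a rotation; the curve closes once that rotation is trivial.\<close>

lemma level_curve_period:
  assumes "M \<ge> M0"
  shows "level_curve M (t + 2 * pi * real n) = cis (real n * rotation_angle M) * level_curve M t"
proof -
  have "polar_angle M (t + 2 * pi * real n) = polar_angle M t + real n * rotation_angle M"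
  proof (induction n)
    case (Suc n)
    then show ?case using polar_angle_period[OF assms, of "t + 2 * pi * real n"]
      by (simp add: algebra_simps)
  qed simp
  moreover have "sin (t + 2 * pi * real n) = sin t"
    using sin.plus_of_nat[of t n] by (simp add: mult_ac)
  ultimately show ?thesis by (simp add: level_curve_def cis_mult[symmetric] mult_ac)
qed

text \<open>The derivative is a quotient of positive terms. Hence the largest radius occurs where
  sin t = 1.\<close>

lemma level_radius_less:
  assumes "M \<ge> M0" "-1 \<le> \<sigma>" "\<sigma> < \<sigma>'" "\<sigma>' \<le> 1"
  shows "level_radius M \<sigma> < level_radius M \<sigma>'"
proof (rule DERIV_pos_imp_increasing[OF \<open>\<sigma> < \<sigma>'\<close>], goal_cases)
  case (1 x)
  then have "\<bar>x\<bar> < 2" using assms by linarith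
  then show ?case
    using DERIV_level_radius[of M x] level_radius_pos[of M x] level_slope_pos[of M x] assms
    by (intro exI[of _ "level_radius M x / (level_radius M x * h (level_radius M x) - x)"]) auto
qed

text \<open>A rotation preserves the largest distance from the origin, which is the radius at
  \<sigma> = 1, attained at t = pi/2; the level equation there returns M^2, hence M.\<close>

lemma level_curve_congruent_imp_eq:
  assumes M: "M \<ge> M0" and N: "N \<ge> M0" and w: "norm w = 1"
    and eq: "(\<lambda>z. w * z) ` range (level_curve M) = range (level_curve N)"
  shows "M = N"
proof -
  have le: "level_radius K (sin t) \<le> level_radius K 1" if "K \<ge> M0" for K t
    using level_radius_less[of K "sin t" 1] that by (cases "sin t = 1") (auto simp: order.strict_iff_order)
  have "w * level_curve M (pi/2) \<in> range (level_curve N)" unfolding eq[symmetric] by blast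
  then obtain t where "w * level_curve M (pi/2) = level_curve N t" by auto
  from arg_cong[OF this, of norm] have 1: "level_radius M 1 \<le> level_radius N 1"
    using le[OF N, of t] norm_level_curve[OF M, of "pi/2"] norm_level_curve[OF N] w by (simp add: norm_mult)
  have "level_curve N (pi/2) \<in> (\<lambda>z. w * z) ` range (level_curve M)" unfolding eq by blast
  then obtain t where "level_curve N (pi/2) = w * level_curve M t" by auto
  from arg_cong[OF this, of norm] have 2: "level_radius N 1 \<le> level_radius M 1"
    using le[OF M, of t] norm_level_curve[OF M] norm_level_curve[OF N, of "pi/2"] w by (simp add: norm_mult)
  from 1 2 have "M\<^sup>2 / 2 = N\<^sup>2 / 2"
    using level_radius(2)[OF M, of 1] level_radius(2)[OF N, of 1] by simp
  then show ?thesis using M N M0_pos by (simp add: power2_eq_iff_nonneg)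
qed


text \<open>With p = h(r) - sin t / r one finds r' = cos t / p, U' = cis(\<theta>) / p and \<theta>'
  = h(r) / p, so the tangent turns by h(r) per unit length.\<close>

lemma level_curve_closed:
  assumes M: "M \<ge> M0" and n: "n > 0" and closes: "cis (real n * rotation_angle M) = 1"
    and H: "\<And>p. H p = h (norm p)" and \<alpha>: "0 < \<alpha>" "\<alpha> < 1"
  shows "closed_curve_C2a_curv \<alpha> H (level_curve M)"
proof -
  \<comment> \<open>The endings 1 and 2 mark derivatives in t, in the shape that the quotient rule
    produces; \<open>1 / p\<close> is the speed of the curve.\<close>
  define r where "r t = level_radius M (sin t)" for t
  define p where "p t = h (r t) - sin t / r t" for t
  define r1 where "r1 t = cos t / p t" for t
  define p1 where "p1 t = h1 (r t) * r1 t - (cos t * r t - sin t * r1 t) / (r t * r t)" for t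
  define r2 where "r2 t = (- sin t * p t - cos t * p1 t) / (p t * p t)" for t
  define p2 where "p2 t = h2 (r t) * r1 t * r1 t + h1 (r t) * r2 t
    - ((- sin t * r t + cos t * r1 t - (cos t * r1 t + sin t * r2 t)) * (r t * r t)
       - (cos t * r t - sin t * r1 t) * (r1 t * r t + r1 t * r t)) / ((r t * r t) * (r t * r t))" for t
  define \<theta> where "\<theta> t = polar_angle M t + t" for t
  \<comment> \<open>\<open>u\<close> and \<open>v\<close> are the tangential and normal components
    of the second derivative of the curve.\<close>
  define u where "u t = - p1 t / (p t * p t)" for t
  define v where "v t = h (r t) / (p t * p t)" for t
  define u1 where "u1 t = (- p2 t * (p t * p t) + p1 t * (p1 t * p t + p1 t * p t))
    / ((p t * p t) * (p t * p t))" for t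
  define v1 where "v1 t = (h1 (r t) * r1 t * (p t * p t) - h (r t) * (p1 t * p t + p1 t * p t))
    / ((p t * p t) * (p t * p t))" for t
  define U1 where "U1 t = of_real (1 / p t) * cis (\<theta> t)" for t
  define U2 where "U2 t = Complex (u t) (v t) * cis (\<theta> t)" for t
  define U3 where "U3 t = (Complex (u1 t) (v1 t) + Complex (u t) (v t) * \<i> * of_real (h (r t) / p t))
    * cis (\<theta> t)" for t
  have r_pos: "r t > 0" for t
    unfolding r_def using M by (intro level_radius_pos abs_sin_le_two)
  have p_pos: "p t > 0" for t
  proof -
    have "0 < r t * h (r t) - sin t"
      using level_slope_pos[OF M abs_sin_le_two[of t]] by (simp add: r_def)
    then show ?thesis using r_pos[of t] by (simp add: p_def field_simps)
  qed
  have nz: "r t \<noteq> 0" "p t \<noteq> 0" for t using r_pos[of t] p_pos[of t] by auto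
  have dr: "(r has_real_derivative r1 t) (at t)" for t
  proof -
    have "\<bar>sin t\<bar> < 2" using abs_sin_le_one[of t] by linarith
    from DERIV_chain2[OF DERIV_level_radius[OF M this] DERIV_sin]
    have "(r has_real_derivative r t / (r t * h (r t) - sin t) * cos t) (at t)"
      unfolding r_def .
    moreover have "r t * h (r t) - sin t = r t * p t"
      using nz[of t] by (simp add: p_def field_simps)
    ultimately show ?thesis using nz[of t] by (simp add: r1_def)
  qed
  have dhr: "((\<lambda>t. h (r t)) has_real_derivative h1 (r t) * r1 t) (at t)"
    and dh1r: "((\<lambda>t. h1 (r t)) has_real_derivative h2 (r t) * r1 t) (at t)" for t
    by (intro DERIV_chain2[OF dh dr] DERIV_chain2[OF dh1 dr] r_pos)+
  have dp: "(p has_real_derivative p1 t) (at t)" for t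
    unfolding p_def[abs_def] p1_def
    by (intro DERIV_diff dhr DERIV_divide DERIV_sin dr nz)
  have dr1: "(r1 has_real_derivative r2 t) (at t)" for t
    unfolding r1_def[abs_def] r2_def
    by (intro DERIV_divide DERIV_cos dp nz)
  have dp1: "(p1 has_real_derivative p2 t) (at t)" for t
    unfolding p1_def[abs_def]
    by (rule derivative_eq_intros dh1r dr dr1 refl | simp add: nz p2_def algebra_simps)+
  have du: "(u has_real_derivative u1 t) (at t)" for t
    unfolding u_def[abs_def]
    by (rule derivative_eq_intros dp dp1 refl | simp add: nz u1_def)+
  have dv: "(v has_real_derivative v1 t) (at t)" for t
    unfolding v_def[abs_def]
    by (rule derivative_eq_intros dhr dp refl | simp add: nz v1_def)+
  have turn: "turn_rate M (sin t) = sin t / (r t * p t)" for t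
    using nz[of t] by (simp add: turn_rate_def r_def[symmetric] p_def field_simps)
  have d\<phi>: "(polar_angle M has_real_derivative sin t / (r t * p t)) (at t)" for t
    using DERIV_polar_angle[OF M, of t] turn by simp
  have d\<theta>: "(\<theta> has_real_derivative h (r t) / p t) (at t)" for t
  proof -
    have "sin t / (r t * p t) + 1 = h (r t) / p t"
      using nz[of t] by (simp add: p_def[of t] field_simps)
    with DERIV_add[OF d\<phi> DERIV_ident, of t] show ?thesis unfolding \<theta>_def[abs_def] by simp
  qed
  have dcis: "((\<lambda>t. cis (f t)) has_vector_derivative (\<i> * of_real f' * cis (f t))) (at t)"
    if "(f has_real_derivative f') (at t)" for f f' t
    using has_derivative_cis[OF that[unfolded has_field_derivative_def]]
    by (simp add: has_vector_derivative_def scaleR_conv_of_real mult_ac)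
  have dre: "((\<lambda>t. of_real (f t) :: complex) has_vector_derivative of_real f') (at t)"
    if "(f has_real_derivative f') (at t)" for f f' t
    using that by (rule has_vector_derivative_of_real)
  have dU: "(level_curve M has_vector_derivative U1 t) (at t)" for t
  proof -
    have "level_curve M = (\<lambda>t. of_real (r t) * cis (polar_angle M t))"
      by (simp add: level_curve_def r_def fun_eq_iff)
    then have "(level_curve M has_vector_derivative
        of_real (r t) * (\<i> * of_real (sin t / (r t * p t)) * cis (polar_angle M t))
        + of_real (r1 t) * cis (polar_angle M t)) (at t)"
      using has_vector_derivative_mult[OF dre[OF dr] dcis[OF d\<phi>]] by simp
    moreover have "of_real (r t) * (\<i> * of_real (sin t / (r t * p t)) * cis (polar_angle M t))
        + of_real (r1 t) * cis (polar_angle M t) = U1 t"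
      using nz[of t] by (simp add: U1_def \<theta>_def r1_def cis_mult[symmetric] complex_eq_iff field_simps)
    ultimately show ?thesis by simp
  qed
  have dU1: "(U1 has_vector_derivative U2 t) (at t)" for t
  proof -
    have "((\<lambda>t. 1 / p t) has_real_derivative u t) (at t)"
      by (rule derivative_eq_intros dp refl | simp add: nz u_def)+
    from has_vector_derivative_mult[OF dre[OF this] dcis[OF d\<theta>]]
    have "(U1 has_vector_derivative of_real (1 / p t) * (\<i> * of_real (h (r t) / p t) * cis (\<theta> t))
        + of_real (u t) * cis (\<theta> t)) (at t)"
      unfolding U1_def[abs_def] .
    moreover have "of_real (1 / p t) * (\<i> * of_real (h (r t) / p t) * cis (\<theta> t))
        + of_real (u t) * cis (\<theta> t) = U2 t"
      using nz[of t] by (simp add: U2_def v_def complex_eq_iff field_simps)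
    ultimately show ?thesis by simp
  qed
  have dU2: "(U2 has_vector_derivative U3 t) (at t)" for t
  proof -
    have "((\<lambda>t. of_real (u t) + \<i> * of_real (v t)) has_vector_derivative
        of_real (u1 t) + \<i> * of_real (v1 t)) (at t)"
      by (intro has_vector_derivative_add has_vector_derivative_mult_right dre du dv)
    from has_vector_derivative_mult[OF this dcis[OF d\<theta>]]
    show ?thesis unfolding U2_def[abs_def] U3_def by (simp add: Complex_eq algebra_simps diff_divide_distrib)
  qed
  have cont: "continuous_on UNIV r" "continuous_on UNIV p" "continuous_on UNIV r1"
    "continuous_on UNIV p1" "continuous_on UNIV \<theta>" "continuous_on UNIV (\<lambda>t. h (r t))"
    "continuous_on UNIV (\<lambda>t. h1 (r t))" "continuous_on UNIV u" "continuous_on UNIV v"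
    by (auto intro!: continuous_at_imp_continuous_on DERIV_isCont
        intro: dr dp dr1 dp1 d\<theta> dhr dh1r du dv)
  have cont_h2r: "continuous_on UNIV (\<lambda>t. h2 (r t))"
    by (rule continuous_on_compose2[OF cont_h2 cont(1)]) (auto simp: r_pos)
  \<comment> \<open>The third derivative involves \<open>h\<close> only up to \<open>h2\<close>, so
    it is continuous, and periodicity turns this into a Hoelder bound for the second
    derivative.\<close>
  have "continuous_on UNIV U3"
    unfolding U3_def u1_def v1_def p2_def r2_def Complex_eq
    by (intro continuous_intros cont cont_h2r continuous_on_cis ballI) (auto simp: nz)
  moreover define T where "T = 2 * pi * real n"
  have "T > 0" using n by (simp add: T_def)
  have perU: "level_curve M (t + T) = level_curve M t" for t
    using level_curve_period[OF M, of t n] closes by (simp add: T_def)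
  have "U2 (t + T) = U2 t" for t
    by (rule vector_derivative_periodic[OF dU1 vector_derivative_periodic[OF dU perU]])
  ultimately have Hoelder: "\<exists>K. \<forall>s t. norm (U2 s - U2 t) \<le> K * \<bar>s - t\<bar> powr \<alpha>"
    by (intro C1_periodic_Hoelder[OF dU2 _ \<open>T > 0\<close> _ \<alpha>])
  have curv: "curvature (U1 t) (U2 t) = H (level_curve M t)" for t
  proof -
    \<comment> \<open>Only the normal component survives; dividing by the cube of the speed leaves
      \<open>v\<close> times p^2, which is h(r).\<close>
    have "inner (\<i> * U1 t) (U2 t) = v t / p t * ((cos (\<theta> t))\<^sup>2 + (sin (\<theta> t))\<^sup>2)"
      by (simp add: U1_def U2_def inner_complex_def algebra_simps power2_eq_square
          add_divide_distrib diff_divide_distrib del: sin_cos_squared_add sin_cos_squared_add2 sin_cos_squared_add3)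
    moreover have "norm (U1 t) = 1 / p t"
      using p_pos[of t] by (simp add: U1_def norm_mult norm_divide)
    moreover have "H (level_curve M t) = h (r t)"
      by (simp add: H norm_level_curve M r_def)
    ultimately show ?thesis
      using nz[of t] by (simp add: curvature_def v_def power3_eq_cube power_divide)
  qed
  have "U1 t \<noteq> 0" for t using nz[of t] by (simp add: U1_def)
  moreover have "continuous_on UNIV U2"
    by (intro continuous_at_imp_continuous_on ballI has_vector_derivative_continuous[OF dU2])
  ultimately show ?thesis
    unfolding closed_curve_C2a_curv_def
    using \<open>T > 0\<close> perU dU dU1 Hoelder curv by blast
qed

end

subsection \<open>Asymptotics of the rotation angle\<close>

text \<open>Stated outside the locale because \<open>R\<close> is chosen from this limit before the
  locale can be interpreted.\<close>

lemma expansion_imp_tendsto_1: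
  fixes h :: "real \<Rightarrow> real"
  assumes "\<gamma> > 0" "\<beta> > 0"
    and expansion: "((\<lambda>s. s powr (\<gamma> + 1) * (h s - 1 - a * s powr (-\<gamma>) - b * s powr (-(\<gamma> + \<beta>))))
      \<longlongrightarrow> 0) at_top" (is "(?e \<longlongrightarrow> 0) at_top")
  shows "(h \<longlongrightarrow> 1) at_top"
proof -
  have "((\<lambda>s. 1 + a * s powr (-\<gamma>) + b * s powr (-(\<gamma> + \<beta>)) + s powr (-(\<gamma> + 1)) * ?e s)
      \<longlongrightarrow> 1 + a * 0 + b * 0 + 0 * 0) at_top"
    by (intro tendsto_intros expansion tendsto_neg_powr filterlim_ident) (use assms in auto)
  moreover have "\<forall>\<^sub>F s in at_top. 1 + a * s powr (-\<gamma>) + b * s powr (-(\<gamma> + \<beta>)) + s powr (-(\<gamma> + 1)) * ?e s = h s"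
    using eventually_gt_at_top[of 0]
    by eventually_elim (simp flip: mult.assoc powr_add)
  ultimately show ?thesis by (simp add: filterlim_cong[OF refl refl])
qed

text \<open>All ranges of the original exponent reduce to this form. The remainder of
  \<open>s * h s\<close> is o(s^(-\<gamma>)), the order at which the paired turn rates are
  compared.\<close>

locale radial_curvature_expansion = radial_curvature +
  fixes a b \<gamma> \<beta> :: real
  assumes \<gamma>: "\<gamma> > 1" and \<beta>: "\<beta> > 0"
    and expansion: "((\<lambda>s. s powr (\<gamma> + 1) * (h s - 1 - a * s powr (-\<gamma>) - b * s powr (-(\<gamma> + \<beta>))))
      \<longlongrightarrow> 0) at_top"
begin

text \<open>Convergence along this filter is convergence as \<open>M \<longlonglongrightarrow> \<infinity>\<close>, uniformly in \<open>\<sigma> = sin t\<close>.\<close>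

abbreviation pairs :: "(real \<times> real) filter" where
  "pairs \<equiv> at_top \<times>\<^sub>F principal {-1..1}"

lemma eventually_pairs:
  "eventually P pairs \<longleftrightarrow> (\<forall>\<^sub>F M in at_top. \<forall>\<sigma>\<in>{-1..1}. P (M, \<sigma>))"
proof
  assume "\<forall>\<^sub>F M in at_top. \<forall>\<sigma>\<in>{-1..1}. P (M, \<sigma>)"
  then show "eventually P pairs"
    unfolding eventually_prod_filter eventually_principal
    by (intro exI[of _ "\<lambda>M. \<forall>\<sigma>\<in>{-1..1}. P (M, \<sigma>)"] exI[of _ "\<lambda>\<sigma>. \<sigma> \<in> {-1..1}"]) auto
qed (auto simp: eventually_prod_filter eventually_principal elim: eventually_mono)

lemma filterlim_fst_pairs: "filterlim fst at_top pairs"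
  by (rule filterlim_fst)

lemma eventually_pairs_bounds: "\<forall>\<^sub>F z in pairs. fst z \<ge> K \<and> \<bar>snd z\<bar> \<le> 1"
  unfolding eventually_pairs using eventually_ge_at_top[of K]
  by eventually_elim (auto simp: abs_le_iff)

lemma filterlim_uminus_snd: "filterlim (\<lambda>z. (fst z, - snd z)) pairs pairs"
  unfolding filterlim_iff eventually_pairs
  by (intro allI impI, erule eventually_mono) force

text \<open>Along \<open>pairs\<close> the second coordinate has no limit, so its bound 1 replaces
  the product rule for limits.\<close>

lemma tendsto_times_snd_0:
  fixes f :: "real \<times> real \<Rightarrow> real"
  assumes "(f \<longlongrightarrow> 0) pairs"
  shows "((\<lambda>z. f z * snd z) \<longlongrightarrow> 0) pairs"
proof (rule Lim_null_comparison[OF _ tendsto_rabs_zero[OF assms]])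
  show "\<forall>\<^sub>F z in pairs. norm (f z * snd z) \<le> \<bar>f z\<bar>"
    using eventually_pairs_bounds[of 0]
    by eventually_elim (auto simp: abs_mult intro: mult_left_le)
qed

abbreviation \<rho> :: "real \<times> real \<Rightarrow> real" where
  "\<rho> z \<equiv> level_radius (fst z) (snd z)"

text \<open>The prime marks the mirrored sine, not a derivative: the two radii belong to t and
  -t.\<close>

abbreviation \<rho>' :: "real \<times> real \<Rightarrow> real" where
  "\<rho>' z \<equiv> level_radius (fst z) (- snd z)"

lemma filterlim_level_radius: "filterlim \<rho> at_top pairs"
  unfolding filterlim_at_top
proof
  fix Z
  define Y where "Y = max Z R"
  have "filterlim (\<lambda>z. (fst z)\<^sup>2) at_top pairs"
    by (intro filterlim_pow_at_top filterlim_fst_pairs) simp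
  \<comment> \<open>If the radius stayed below \<open>Y\<close>, monotonicity would give M^2/2 \<le>
    G Y - Y \<sigma> \<le> G Y + Y, which this inequality forbids.\<close>
  then have "\<forall>\<^sub>F z in pairs. (fst z)\<^sup>2 > 2 * (G Y + Y)"
    by (simp add: filterlim_at_top_dense)
  then show "\<forall>\<^sub>F z in pairs. Z \<le> \<rho> z"
    using eventually_pairs_bounds[of M0]
  proof eventually_elim
    case (elim z)
    show ?case
    proof (rule ccontr)
      assume "\<not> Z \<le> \<rho> z"
      then have "\<rho> z \<le> Y" by (simp add: Y_def)
      have \<sigma>: "\<bar>snd z\<bar> \<le> 2" "snd z \<le> 2" using elim by linarith+
      have "0 \<le> (G Y - Y * snd z) - (fst z)\<^sup>2 / 2"
        using level_growth[of "\<rho> z" Y "snd z"] level_radius[OF _ \<sigma>(1), of "fst z"] elim \<sigma> \<open>\<rho> z \<le> Y\<close>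
        by linarith
      moreover have "Y * - snd z \<le> Y * 1"
        using elim R_pos by (intro mult_left_mono) (auto simp: Y_def)
      ultimately show False using elim by simp
    qed
  qed
qed

text \<open>
  Only the explicit part \<open>excess_main\<close> of \<open>excess\<close> can be differentiated with good bounds; the
  remainder \<open>o(s\<^bsup>-\<gamma>\<^esup>)\<close> is small enough to be estimated pointwise.
\<close>

definition excess :: "real \<Rightarrow> real" where "excess s = s * h s - s"
definition excess_int :: "real \<Rightarrow> real" where "excess_int s = G s - s\<^sup>2 / 2"
definition excess_main :: "real \<Rightarrow> real" where
  "excess_main s = a * s powr (1 - \<gamma>) + b * s powr (1 - \<gamma> - \<beta>)"
definition excess_main' :: "real \<Rightarrow> real" where
  "excess_main' s = a * (1 - \<gamma>) * s powr (-\<gamma>) + b * (1 - \<gamma> - \<beta>) * s powr (-\<beta> - \<gamma>)"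

lemma DERIV_excess_int: "s > 0 \<Longrightarrow> (excess_int has_real_derivative excess s) (at s)"
  unfolding excess_int_def[abs_def] excess_def
  by (auto intro!: derivative_eq_intros dG)

lemma DERIV_excess_main: "s > 0 \<Longrightarrow> (excess_main has_real_derivative excess_main' s) (at s)"
  unfolding excess_main_def[abs_def] excess_main'_def
  by (auto intro!: derivative_eq_intros simp: algebra_simps)

lemma excess_main'_asymp: "((\<lambda>s. s powr \<gamma> * excess_main' s) \<longlongrightarrow> a * (1 - \<gamma>)) at_top"
proof -
  have "((\<lambda>s. a * (1 - \<gamma>) + b * (1 - \<gamma> - \<beta>) * s powr (-\<beta>)) \<longlongrightarrow> a * (1 - \<gamma>) + b * (1 - \<gamma> - \<beta>) * 0) at_top"
    by (intro tendsto_intros tendsto_neg_powr filterlim_ident) (use \<beta> in auto)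
  moreover have "\<forall>\<^sub>F s in at_top. a * (1 - \<gamma>) + b * (1 - \<gamma> - \<beta>) * s powr (-\<beta>) = s powr \<gamma> * excess_main' s"
    using eventually_gt_at_top[of 0]
    by eventually_elim (simp add: excess_main'_def algebra_simps flip: powr_add)
  ultimately show ?thesis by (simp add: filterlim_cong[OF refl refl])
qed

lemma excess_remainder:
  "((\<lambda>s. s powr \<gamma> * (excess s - excess_main s)) \<longlongrightarrow> 0) at_top"
proof (rule Lim_transform_eventually[OF expansion])
  show "\<forall>\<^sub>F s in at_top. s powr (\<gamma> + 1) * (h s - 1 - a * s powr (-\<gamma>) - b * s powr (-(\<gamma> + \<beta>)))
      = s powr \<gamma> * (excess s - excess_main s)"
    using eventually_gt_at_top[of 0]
  proof eventually_elim
    case (elim s)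
    have "s powr (1 - \<gamma>) = s * s powr (-\<gamma>)" "s powr (1 - \<gamma> - \<beta>) = s * s powr (-(\<gamma> + \<beta>))"
      "s powr (\<gamma> + 1) = s powr \<gamma> * s"
      using elim powr_add[of s 1 "-\<gamma>"] powr_add[of s 1 "-(\<gamma> + \<beta>)"] powr_add[of s \<gamma> 1]
      by (simp_all add: algebra_simps)
    then show ?case by (simp add: excess_def excess_main_def algebra_simps)
  qed
qed

lemma excess_asymp: "((\<lambda>s. s powr (\<gamma> - 1) * excess s) \<longlongrightarrow> a) at_top"
proof -
  have inv: "((\<lambda>s::real. s powr (-1)) \<longlongrightarrow> 0) at_top"
    by (intro tendsto_neg_powr filterlim_ident) simp
  have "((\<lambda>s. a + b * s powr (-\<beta>) + s powr (-1) * (s powr \<gamma> * (excess s - excess_main s)))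
      \<longlongrightarrow> a + b * 0 + 0 * 0) at_top"
    by (intro tendsto_intros tendsto_neg_powr filterlim_ident inv excess_remainder) (use \<beta> in auto)
  moreover have "\<forall>\<^sub>F s in at_top. a + b * s powr (-\<beta>) + s powr (-1) * (s powr \<gamma> * (excess s - excess_main s))
      = s powr (\<gamma> - 1) * excess s"
    using eventually_gt_at_top[of 0]
  proof eventually_elim
    case (elim s)
    have "s powr (-1) * s powr \<gamma> = s powr (\<gamma> - 1)" 
      using elim by (simp add: powr_diff)
    moreover have "s powr (\<gamma> - 1) * excess_main s = a + b * s powr (-\<beta>)"
      using elim by (simp add: excess_main_def algebra_simps flip: powr_add)
    ultimately show ?case by (simp add: right_diff_distrib flip: mult.assoc)
  qed
  ultimately show ?thesis by (simp add: filterlim_cong[OF refl refl])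
qed

lemma excess_tendsto_0: "(excess \<longlongrightarrow> 0) at_top"
proof -
  have "((\<lambda>s. s powr (1 - \<gamma>) * (s powr (\<gamma> - 1) * excess s)) \<longlongrightarrow> 0 * a) at_top"
    using \<gamma> tendsto_neg_powr[of "1 - \<gamma>" "\<lambda>s. s" at_top]
    by (intro tendsto_mult excess_asymp) (auto simp: filterlim_ident)
  moreover have "\<forall>\<^sub>F s in at_top. s powr (1 - \<gamma>) * (s powr (\<gamma> - 1) * excess s) = excess s"
    using eventually_gt_at_top[of 0]
    by eventually_elim (simp flip: mult.assoc powr_add)
  ultimately show ?thesis by (simp add: filterlim_cong[OF refl refl])
qed

text \<open>L'Hospital's rule with a divergent denominator: the derivative \<open>excess\<close>
  tends to 0.\<close>

lemma excess_int_sublinear: "((\<lambda>s. excess_int s / s) \<longlongrightarrow> 0) at_top"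
proof (rule lhospital_at_top_at_top[where g' = "\<lambda>_. 1" and f' = excess])
  show "\<forall>\<^sub>F x in at_top. (excess_int has_real_derivative excess x) (at x)"
    using eventually_gt_at_top[of 0] by eventually_elim (rule DERIV_excess_int)
qed (auto intro: excess_tendsto_0 filterlim_ident DERIV_ident)

lemma h_tendsto_1: "(h \<longlongrightarrow> 1) at_top"
  using \<gamma> by (intro expansion_imp_tendsto_1[OF _ \<beta> expansion]) simp

text \<open>Completing the square in the level equation gives (r - M - \<sigma>)(r - \<sigma> + M) =
  \<sigma>^2 - 2 E(r) with E = \<open>excess_int\<close>. The right side is o(r) and the second
  factor is at least r - 1, so the first factor tends to 0 uniformly.\<close>

lemma level_radius_asymp: "((\<lambda>z. \<rho> z - fst z - snd z) \<longlongrightarrow> 0) pairs"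
proof -
  have "((\<lambda>x. (inverse x + 2 * \<bar>excess_int x / x\<bar>) / (1 - inverse x)) \<longlongrightarrow> (0 + 2 * \<bar>0\<bar>) / (1 - 0)) at_top"
    by (intro tendsto_intros excess_int_sublinear tendsto_inverse_0_at_top filterlim_ident) simp
  then have lim: "((\<lambda>z. (inverse (\<rho> z) + 2 * \<bar>excess_int (\<rho> z) / \<rho> z\<bar>) / (1 - inverse (\<rho> z))) \<longlongrightarrow> 0) pairs"
    by (intro filterlim_compose[OF _ filterlim_level_radius]) simp
  have "\<forall>\<^sub>F z in pairs. \<rho> z > 1"
    using filterlim_level_radius by (simp add: filterlim_at_top_dense)
  then have "\<forall>\<^sub>F z in pairs. norm (\<rho> z - fst z - snd z)
      \<le> (inverse (\<rho> z) + 2 * \<bar>excess_int (\<rho> z) / \<rho> z\<bar>) / (1 - inverse (\<rho> z))"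
    using eventually_pairs_bounds[of M0]
  proof eventually_elim
    case (elim z)
    define M \<sigma> r where "M = fst z" and "\<sigma> = snd z" and "r = \<rho> z"
    have z: "r > 1" "M > 0" "M \<ge> M0" "\<bar>\<sigma>\<bar> \<le> 1" using elim M0_pos by (auto simp: M_def \<sigma>_def r_def)
    have "G r - r * \<sigma> = M\<^sup>2 / 2"
      unfolding r_def M_def \<sigma>_def using elim by (intro level_radius) auto
    then have eq: "(r - M - \<sigma>) * (r - \<sigma> + M) = \<sigma>\<^sup>2 - 2 * excess_int r"
      by (simp add: excess_int_def field_simps power2_eq_square)
    have "\<bar>r - M - \<sigma>\<bar> * (r - 1) \<le> \<bar>r - M - \<sigma>\<bar> * (r - \<sigma> + M)"
      using z by (intro mult_left_mono) auto
    also have "\<dots> = \<bar>\<sigma>\<^sup>2 - 2 * excess_int r\<bar>"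
      using z unfolding eq[symmetric] by (simp add: abs_mult)
    also have "\<dots> \<le> 1 + 2 * \<bar>excess_int r\<bar>"
      using z abs_square_le_1[of \<sigma>] abs_triangle_ineq4[of "\<sigma>\<^sup>2" "2 * excess_int r"] by simp
    finally have "\<bar>r - M - \<sigma>\<bar> \<le> (1 + 2 * \<bar>excess_int r\<bar>) / (r - 1)"
      using z by (simp add: field_simps)
    also have "\<dots> = (inverse r + 2 * \<bar>excess_int r / r\<bar>) / (1 - inverse r)"
      using z by (simp add: field_simps)
    finally show ?case by (simp add: M_def \<sigma>_def r_def)
  qed
  then show ?thesis by (rule Lim_null_comparison[OF _ lim])
qed

lemma snd_over_fst: "((\<lambda>z. snd z / fst z) \<longlongrightarrow> 0) pairs"
  using tendsto_times_snd_0[OF tendsto_inverse_0_at_top[OF filterlim_fst_pairs]]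
  by (simp add: field_simps)

lemma level_radius_ratio: "((\<lambda>z. \<rho> z / fst z) \<longlongrightarrow> 1) pairs"
proof -
  have "((\<lambda>z. (\<rho> z - fst z - snd z) * inverse (fst z) + snd z / fst z + 1) \<longlongrightarrow> 0 * 0 + 0 + 1) pairs"
    by (intro tendsto_intros level_radius_asymp snd_over_fst tendsto_inverse_0_at_top filterlim_fst_pairs)
  moreover have "\<forall>\<^sub>F z in pairs. (\<rho> z - fst z - snd z) * inverse (fst z) + snd z / fst z + 1 = \<rho> z / fst z"
    using eventually_pairs_bounds[of 1] by eventually_elim (auto simp: field_simps)
  ultimately show ?thesis by (simp add: filterlim_cong[OF refl refl])
qed

lemma filterlim_level_radius': "filterlim \<rho>' at_top pairs"
  using filterlim_compose[OF filterlim_level_radius filterlim_uminus_snd] by simp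

lemma level_radius_asymp': "((\<lambda>z. \<rho>' z - fst z + snd z) \<longlongrightarrow> 0) pairs"
  using filterlim_compose[OF level_radius_asymp filterlim_uminus_snd] by simp

lemma level_radius_ratio': "((\<lambda>z. \<rho>' z / fst z) \<longlongrightarrow> 1) pairs"
  using filterlim_compose[OF level_radius_ratio filterlim_uminus_snd] by simp

section \<open>Comparison of the quantities at t and -t\<close>

text \<open>The factor (\<xi>/M)^(-k) tends to 1, so powers of M may replace powers of any point
  asymptotic to M.\<close>

lemma rescaled_limit:
  assumes u: "((\<lambda>s. s powr k * u s) \<longlongrightarrow> l) at_top"
    and \<xi>: "filterlim \<xi> at_top pairs" and ratio: "((\<lambda>z. \<xi> z / fst z) \<longlongrightarrow> 1) pairs"
  shows "((\<lambda>z. fst z powr k * u (\<xi> z)) \<longlongrightarrow> l) pairs"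
proof -
  have "((\<lambda>z. (\<xi> z / fst z) powr (-k) * (\<xi> z powr k * u (\<xi> z))) \<longlongrightarrow> 1 powr (-k) * l) pairs"
    by (intro tendsto_intros ratio filterlim_compose[OF u \<xi>]) simp
  moreover have "\<forall>\<^sub>F z in pairs. \<xi> z > 0"
    using \<xi> by (simp add: filterlim_at_top_dense)
  then have "\<forall>\<^sub>F z in pairs. (\<xi> z / fst z) powr (-k) * (\<xi> z powr k * u (\<xi> z)) = fst z powr k * u (\<xi> z)"
    using eventually_pairs_bounds[of 1]
    by eventually_elim (simp add: powr_divide powr_minus field_simps)
  ultimately show ?thesis by (simp add: filterlim_cong[OF refl refl])
qed

text \<open>By the mean value theorem the difference is (r - r') g'(\<xi>) with \<xi> between the
  two radii. Here r - r' = 2\<sigma> + o(1), and \<xi> is asymptotic to M, so M^k g'(\<xi>) tends to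
  l.\<close>

lemma rescaled_difference:
  assumes g: "\<And>s. s > 0 \<Longrightarrow> (g has_real_derivative g' s) (at s)"
    and lim: "((\<lambda>s. s powr k * g' s) \<longlongrightarrow> l) at_top"
  shows "((\<lambda>z. fst z powr k * (g (\<rho> z) - g (\<rho>' z)) - 2 * l * snd z) \<longlongrightarrow> 0) pairs"
proof -
  \<comment> \<open>Either radius may be the larger one, so the point is located between minimum and
    maximum.\<close>
  have mvt: "\<exists>\<xi>. min x y \<le> \<xi> \<and> \<xi> \<le> max x y \<and> g x - g y = (x - y) * g' \<xi>"
    if "x > 0" "y > 0" for x y
  proof (cases x y rule: linorder_cases)
    case less
    have "\<exists>\<xi>>x. \<xi> < y \<and> g y - g x = (y - x) * g' \<xi>"
      by (rule MVT2[OF less]) (use that g in auto)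
    then obtain \<xi> where "x < \<xi>" "\<xi> < y" "g y - g x = (y - x) * g' \<xi>" by blast
    then show ?thesis by (intro exI[of _ \<xi>]) (auto simp: algebra_simps)
  next
    case greater
    have "\<exists>\<xi>>y. \<xi> < x \<and> g x - g y = (x - y) * g' \<xi>"
      by (rule MVT2[OF greater]) (use that g in auto)
    then obtain \<xi> where "y < \<xi>" "\<xi> < x" "g x - g y = (x - y) * g' \<xi>" by blast
    then show ?thesis by (intro exI[of _ \<xi>]) auto
  qed auto
  then have "\<forall>z. \<exists>\<xi>. \<rho> z > 0 \<and> \<rho>' z > 0 \<longrightarrow> min (\<rho> z) (\<rho>' z) \<le> \<xi> \<and> \<xi> \<le> max (\<rho> z) (\<rho>' z) \<and>
      g (\<rho> z) - g (\<rho>' z) = (\<rho> z - \<rho>' z) * g' \<xi>" by blast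
  then obtain \<xi> where \<xi>: "\<And>z. \<rho> z > 0 \<Longrightarrow> \<rho>' z > 0 \<Longrightarrow> min (\<rho> z) (\<rho>' z) \<le> \<xi> z \<and>
      \<xi> z \<le> max (\<rho> z) (\<rho>' z) \<and> g (\<rho> z) - g (\<rho>' z) = (\<rho> z - \<rho>' z) * g' (\<xi> z)" by metis
  have pos: "\<forall>\<^sub>F z in pairs. \<rho> z > 0 \<and> \<rho>' z > 0 \<and> fst z > 0"
    using eventually_pairs_bounds[of M0]
    by eventually_elim (use M0_pos in \<open>auto intro!: level_radius_pos\<close>)
  have \<xi>_top: "filterlim \<xi> at_top pairs"
    unfolding filterlim_at_top
  proof
    fix Z
    have "\<forall>\<^sub>F z in pairs. Z \<le> \<rho> z" "\<forall>\<^sub>F z in pairs. Z \<le> \<rho>' z"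
      using filterlim_level_radius filterlim_level_radius' by (simp_all add: filterlim_at_top)
    then show "\<forall>\<^sub>F z in pairs. Z \<le> \<xi> z"
      using pos by eventually_elim (use \<xi> in force)
  qed
  have between: "min (\<rho> z / fst z) (\<rho>' z / fst z) \<le> \<xi> z / fst z \<and>
      \<xi> z / fst z \<le> max (\<rho> z / fst z) (\<rho>' z / fst z)"
    if "\<rho> z > 0 \<and> \<rho>' z > 0 \<and> fst z > 0" for z
    using \<xi>[of z] that by (auto simp: min_le_iff_disj le_max_iff_disj divide_le_cancel)
  have "((\<lambda>z. \<xi> z / fst z) \<longlongrightarrow> 1) pairs"
  proof (rule tendsto_sandwich)
    show "\<forall>\<^sub>F z in pairs. min (\<rho> z / fst z) (\<rho>' z / fst z) \<le> \<xi> z / fst z"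
      using pos by eventually_elim (use between in blast)
    show "\<forall>\<^sub>F z in pairs. \<xi> z / fst z \<le> max (\<rho> z / fst z) (\<rho>' z / fst z)"
      using pos by eventually_elim (use between in blast)
    show "((\<lambda>z. min (\<rho> z / fst z) (\<rho>' z / fst z)) \<longlongrightarrow> 1) pairs"
      using tendsto_min[OF level_radius_ratio level_radius_ratio'] by simp
    show "((\<lambda>z. max (\<rho> z / fst z) (\<rho>' z / fst z)) \<longlongrightarrow> 1) pairs"
      using tendsto_max[OF level_radius_ratio level_radius_ratio'] by simp
  qed
  from rescaled_limit[OF lim \<xi>_top this]
  have slope: "((\<lambda>z. fst z powr k * g' (\<xi> z)) \<longlongrightarrow> l) pairs" .
  then have slope0: "((\<lambda>z. fst z powr k * g' (\<xi> z) - l) \<longlongrightarrow> 0) pairs" by (rule LIM_zero)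
  have gap: "((\<lambda>z. (\<rho> z - fst z - snd z) - (\<rho>' z - fst z + snd z)) \<longlongrightarrow> 0 - 0) pairs"
    by (intro tendsto_diff level_radius_asymp level_radius_asymp')
  \<comment> \<open>The split lets \<sigma>, which has no limit, multiply only a term that tends to
    0.\<close>
  have "((\<lambda>z. fst z powr k * g' (\<xi> z) * ((\<rho> z - fst z - snd z) - (\<rho>' z - fst z + snd z))
      + 2 * ((fst z powr k * g' (\<xi> z) - l) * snd z)) \<longlongrightarrow> l * (0 - 0) + 2 * 0) pairs"
    by (intro tendsto_add tendsto_mult slope gap tendsto_const tendsto_times_snd_0 slope0)
  moreover have "\<forall>\<^sub>F z in pairs. fst z powr k * g' (\<xi> z) * ((\<rho> z - fst z - snd z) - (\<rho>' z - fst z + snd z))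
      + 2 * ((fst z powr k * g' (\<xi> z) - l) * snd z)
      = fst z powr k * (g (\<rho> z) - g (\<rho>' z)) - 2 * l * snd z"
    using pos
  proof eventually_elim
    case (elim z)
    then have "g (\<rho> z) - g (\<rho>' z) = (\<rho> z - \<rho>' z) * g' (\<xi> z)" using \<xi> by blast
    then show ?case by (simp only:) (simp add: algebra_simps)
  qed
  ultimately show ?thesis by (simp add: filterlim_cong[OF refl refl])
qed


text \<open>With f(s) = s h(s) the pair sums to \<sigma> (f(r') - f(r) + 2\<sigma>) / ((f(r) -
  \<sigma>)(f(r') + \<sigma>)), whose denominator is asymptotic to M^2. Scaled by M^\<gamma>, the
  part 2\<sigma> - (r - r') of the bracket behaves like 2a\<sigma> and the excess difference like
  2a(1 - \<gamma>)\<sigma>; subtracting leaves 2a\<gamma>\<sigma>.\<close>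

lemma turn_rate_pair_asymp:
  "((\<lambda>z. fst z powr (\<gamma> + 2) * (turn_rate (fst z) (snd z) + turn_rate (fst z) (- snd z))
      - 2 * a * \<gamma> * (snd z)\<^sup>2) \<longlongrightarrow> 0) pairs"
proof -
  define f where "f s = s * h s" for s
  define m where "m z = ((\<rho> z + \<rho>' z) / 2) / fst z" for z
  define e where "e s = excess s - excess_main s" for s
  define X where "X z = ((f (\<rho> z) - snd z) / fst z) * ((f (\<rho>' z) + snd z) / fst z)" for z
  define I where "I z = fst z powr (\<gamma> - 1) * (excess_int (\<rho> z) - excess_int (\<rho>' z)) - 2 * a * snd z" for z
  define J where "J z = fst z powr \<gamma> * (excess_main (\<rho> z) - excess_main (\<rho>' z))
    - 2 * (a * (1 - \<gamma>)) * snd z" for z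
  define E where "E z = fst z powr \<gamma> * e (\<rho> z) - fst z powr \<gamma> * e (\<rho>' z)" for z
  \<comment> \<open>\<open>I\<close>, \<open>J\<close> and \<open>E\<close> are the null errors of
    \<open>excess_int\<close>, \<open>excess_main\<close> and the remainder. They are combined so
    that W + 2a\<gamma>\<sigma> equals M^\<gamma> (f(r') - f(r) + 2\<sigma>).\<close>
  define W where "W z = inverse (m z) * I z + 2 * a * ((inverse (m z) - 1) * snd z) - J z - E z" for z
  have m: "(m \<longlongrightarrow> 1) pairs"
  proof -
    have "((\<lambda>z. (\<rho> z / fst z + \<rho>' z / fst z) / 2) \<longlongrightarrow> (1 + 1) / 2) pairs"
      by (intro tendsto_intros level_radius_ratio level_radius_ratio') simp
    then show ?thesis unfolding m_def[abs_def] by (simp add: add_divide_distrib mult.commute)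
  qed
  have I: "(I \<longlongrightarrow> 0) pairs"
    unfolding I_def[abs_def] by (rule rescaled_difference[OF DERIV_excess_int excess_asymp])
  have J: "(J \<longlongrightarrow> 0) pairs"
    unfolding J_def[abs_def] by (rule rescaled_difference[OF DERIV_excess_main excess_main'_asymp])
  have "(E \<longlongrightarrow> 0 - 0) pairs"
    unfolding E_def[abs_def] e_def
    by (intro tendsto_diff rescaled_limit excess_remainder filterlim_level_radius
        filterlim_level_radius' level_radius_ratio level_radius_ratio')
  moreover have "((\<lambda>z. inverse (m z)) \<longlongrightarrow> 1) pairs"
    using tendsto_inverse[OF m] by simp
  ultimately have "(W \<longlongrightarrow> 1 * 0 + 2 * a * 0 - 0 - (0 - 0)) pairs"
    unfolding W_def[abs_def]
    by (intro tendsto_intros I J tendsto_times_snd_0 LIM_zero)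
  then have W: "(W \<longlongrightarrow> 0) pairs" by simp
  have h: "((\<lambda>z. h (\<rho> z)) \<longlongrightarrow> 1) pairs" "((\<lambda>z. h (\<rho>' z)) \<longlongrightarrow> 1) pairs"
    by (intro filterlim_compose[OF h_tendsto_1] filterlim_level_radius filterlim_level_radius')+
  have "((\<lambda>z. (\<rho> z / fst z * h (\<rho> z) - snd z / fst z) * (\<rho>' z / fst z * h (\<rho>' z) + snd z / fst z))
      \<longlongrightarrow> (1 * 1 - 0) * (1 * 1 + 0)) pairs"
    by (intro tendsto_intros level_radius_ratio level_radius_ratio' h snd_over_fst)
  then have "(X \<longlongrightarrow> 1) pairs"
    unfolding X_def[abs_def] f_def by (simp add: diff_divide_distrib add_divide_distrib)
  then have Y: "((\<lambda>z. inverse (X z)) \<longlongrightarrow> 1) pairs"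
    using tendsto_inverse[of X 1 pairs] by simp
  have "((\<lambda>z. (inverse (X z) * W z) * snd z + 2 * a * \<gamma> * ((inverse (X z) - 1) * snd z * snd z))
      \<longlongrightarrow> 0 + 2 * a * \<gamma> * 0) pairs"
    using tendsto_mult[OF Y W]
    by (intro tendsto_add tendsto_mult tendsto_const tendsto_times_snd_0 LIM_zero Y) simp
  moreover have "\<forall>\<^sub>F z in pairs. (inverse (X z) * W z) * snd z + 2 * a * \<gamma> * ((inverse (X z) - 1) * snd z * snd z)
     = fst z powr (\<gamma> + 2) * (turn_rate (fst z) (snd z) + turn_rate (fst z) (- snd z))
      - 2 * a * \<gamma> * (snd z)\<^sup>2"
    using eventually_pairs_bounds[of M0]
  proof eventually_elim
    case (elim z)
    define M \<sigma> r r' where "M = fst z" and "\<sigma> = snd z" and "r = \<rho> z" and "r' = \<rho>' z"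
    have M: "M \<ge> M0" "M > 0" and \<sigma>: "\<bar>\<sigma>\<bar> \<le> 2" "\<bar>-\<sigma>\<bar> \<le> 2"
      using elim M0_pos by (auto simp: M_def \<sigma>_def)
    have pos: "r > 0" "r' > 0" "f r - \<sigma> > 0" "f r' + \<sigma> > 0"
      using level_radius_pos[OF M(1) \<sigma>(1)] level_radius_pos[OF M(1) \<sigma>(2)]
        level_slope_pos[OF M(1) \<sigma>(1)] level_slope_pos[OF M(1) \<sigma>(2)]
      by (auto simp: r_def r'_def M_def \<sigma>_def f_def)
    have "G r - r * \<sigma> = G r' + r' * \<sigma>"
      using level_radius(2)[OF M(1) \<sigma>(1)] level_radius(2)[OF M(1) \<sigma>(2)]
      by (simp add: r_def r'_def M_def \<sigma>_def)
    \<comment> \<open>Both radii lie on the same level; the difference of squares factors and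
      expresses 2\<sigma> - (r - r') through \<open>excess_int\<close>.\<close>
    then have kq: "excess_int r - excess_int r' = (r + r') / 2 * (2 * \<sigma> - (r - r'))"
      by (simp add: excess_int_def field_simps power2_eq_square)
    define k where "k = (r + r') / 2"
    have mz: "m z = k / M" and "k > 0"
      using pos by (simp_all add: m_def k_def r_def r'_def M_def)
    then have gap: "inverse (m z) * (excess_int r - excess_int r') = M * (2 * \<sigma> - (r - r'))"
      unfolding mz kq k_def[symmetric] by simp
    have pM: "M powr \<gamma> = M powr (\<gamma> - 1) * M" "M powr (\<gamma> + 2) = M powr \<gamma> * M\<^sup>2"
      using M by (simp_all add: powr_diff powr_add powr_numeral)
    have "W z + 2 * a * \<gamma> * \<sigma> = M powr (\<gamma> - 1) * (inverse (m z) * (excess_int r - excess_int r'))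
        - M powr \<gamma> * (excess r - excess r')"
      unfolding W_def I_def J_def E_def e_def M_def \<sigma>_def r_def r'_def by (simp add: algebra_simps)
    also have "\<dots> = M powr \<gamma> * (2 * \<sigma> - (r - r') - (excess r - excess r'))"
      unfolding gap pM(1) by (simp add: algebra_simps)
    also have "2 * \<sigma> - (r - r') - (excess r - excess r') = f r' - f r + 2 * \<sigma>"
      by (simp add: excess_def f_def)
    finally have Wz: "W z + 2 * a * \<gamma> * \<sigma> = M powr \<gamma> * (f r' - f r + 2 * \<sigma>)" .
    have XM: "(f r - \<sigma>) * (f r' + \<sigma>) = X z * M\<^sup>2"
      using M(2) by (simp add: X_def r_def r'_def M_def \<sigma>_def power2_eq_square)
    then have X_nz: "X z \<noteq> 0" using pos by auto
    have "turn_rate M \<sigma> + turn_rate M (-\<sigma>) = \<sigma> / (f r - \<sigma>) - \<sigma> / (f r' + \<sigma>)"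
      by (simp add: turn_rate_def f_def r_def r'_def M_def \<sigma>_def)
    also have "\<dots> = \<sigma> * (f r' - f r + 2 * \<sigma>) / ((f r - \<sigma>) * (f r' + \<sigma>))"
      using pos by (simp add: divide_simps) (simp add: algebra_simps)
    finally have sum: "turn_rate M \<sigma> + turn_rate M (-\<sigma>)
        = \<sigma> * (f r' - f r + 2 * \<sigma>) / ((f r - \<sigma>) * (f r' + \<sigma>))" .
    have "M powr (\<gamma> + 2) * (turn_rate M \<sigma> + turn_rate M (-\<sigma>))
        = inverse (X z) * (M powr \<gamma> * (f r' - f r + 2 * \<sigma>)) * \<sigma>"
      unfolding sum pM(2) XM using M X_nz by (simp add: field_simps)
    also have "\<dots> = inverse (X z) * (W z + 2 * a * \<gamma> * \<sigma>) * \<sigma>"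
      unfolding Wz ..
    finally show ?case
      unfolding M_def \<sigma>_def by (simp add: algebra_simps power2_eq_square)
  qed
  ultimately show ?thesis by (simp add: filterlim_cong[OF refl refl])
qed

section \<open>Integration over a period and closing levels\<close>

text \<open>Reflection of t preserves the integral over a symmetric interval, so only the pair sum,
  in which the odd part cancels, has to be estimated.\<close>

lemma rotation_angle_pairing:
  assumes "M \<ge> M0"
  shows "((\<lambda>t. turn_rate M (sin t) + turn_rate M (- sin t)) has_integral 2 * rotation_angle M) {-pi..pi}"
proof -
  have "(\<lambda>t. turn_rate M (sin t)) integrable_on {-pi..pi}"
    using turn_rate_sin_continuous[OF assms]
    by (intro integrable_continuous_real) (auto intro: continuous_on_subset)
  then have 1: "((\<lambda>t. turn_rate M (sin t)) has_integral rotation_angle M) {-pi..pi}"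
    unfolding rotation_angle_def by (rule integrable_integral)
  then have "((\<lambda>t. turn_rate M (sin (-t))) has_integral rotation_angle M) {-pi..-(-pi)}"
    by (subst has_integral_reflect_real) simp
  then show ?thesis using has_integral_add[OF 1] by force
qed

text \<open>The pair estimate is uniform in \<sigma> and can be integrated; (sin t)^2 contributes
  pi, and the factor 2 from the pairing cancels.\<close>

lemma rotation_angle_asymp:
  "((\<lambda>M. M powr (\<gamma> + 2) * rotation_angle M) \<longlongrightarrow> a * \<gamma> * pi) at_top"
proof (rule tendstoI)
  fix \<epsilon> :: real assume "\<epsilon> > 0"
  \<comment> \<open>The interval has length 2 pi, so the error is at most \<epsilon> for 2\<Delta>
    and \<epsilon>/2 for \<Delta>.\<close>
  define \<delta> where "\<delta> = \<epsilon> / (2 * pi)"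
  have "\<delta> > 0" using \<open>\<epsilon> > 0\<close> by (simp add: \<delta>_def)
  from tendstoD[OF turn_rate_pair_asymp this]
  have "\<forall>\<^sub>F M in at_top. \<forall>\<sigma>\<in>{-1..1}. \<bar>M powr (\<gamma> + 2) * (turn_rate M \<sigma> + turn_rate M (- \<sigma>))
      - 2 * a * \<gamma> * \<sigma>\<^sup>2\<bar> < \<delta>"
    by (simp add: eventually_pairs)
  then show "\<forall>\<^sub>F M in at_top. dist (M powr (\<gamma> + 2) * rotation_angle M) (a * \<gamma> * pi) < \<epsilon>"
    using eventually_ge_at_top[of M0]
  proof eventually_elim
    case (elim M)
    let ?F = "\<lambda>t. M powr (\<gamma> + 2) * (turn_rate M (sin t) + turn_rate M (- sin t)) - 2 * a * \<gamma> * (sin t)\<^sup>2"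
    have F: "(?F has_integral (M powr (\<gamma> + 2) * (2 * rotation_angle M) - 2 * a * \<gamma> * pi)) (cbox (-pi) pi)"
      unfolding box_real using elim
      by (intro has_integral_diff has_integral_mult_right rotation_angle_pairing has_integral_sin_squared)
    have "norm (M powr (\<gamma> + 2) * (2 * rotation_angle M) - 2 * a * \<gamma> * pi) \<le> \<delta> * Henstock_Kurzweil_Integration.content (cbox (-pi) pi)"
      by (rule has_integral_bound[OF _ F]) (use elim \<open>\<delta> > 0\<close> in \<open>auto intro: less_imp_le\<close>)
    also have "\<dots> = \<epsilon>" by (simp add: \<delta>_def)
    finally have "2 * \<bar>M powr (\<gamma> + 2) * rotation_angle M - a * \<gamma> * pi\<bar> \<le> \<epsilon>"
      by (simp add: abs_if algebra_simps split: if_splits)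
    then show ?case using \<open>\<epsilon> > 0\<close> by (simp add: dist_real_def)
  qed
qed

text \<open>|\<Delta>| is continuous, positive at some \<open>M1\<close> and tends to 0, so it takes
  every value 2 pi/n below |\<Delta>(M1)|, whatever the sign of \<Delta>. Infinitely many values
  require infinitely many levels.\<close>

lemma infinite_closing_levels:
  assumes "a \<noteq> 0"
  shows "infinite {M. M \<ge> M0 \<and> (\<exists>n>0. cis (real n * rotation_angle M) = 1)}"
proof -
  let ?S = "{M. M \<ge> M0 \<and> (\<exists>n>0. cis (real n * rotation_angle M) = 1)}"
  have "\<forall>\<^sub>F M in at_top. M powr (\<gamma> + 2) * rotation_angle M \<noteq> 0"
    using \<gamma> assms by (intro tendsto_imp_eventually_ne[OF rotation_angle_asymp]) auto
  then have "\<forall>\<^sub>F M in at_top. M \<ge> M0 \<and> rotation_angle M \<noteq> 0"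
    using eventually_ge_at_top[of M0] by eventually_elim auto
  then obtain M1 where M1: "M1 \<ge> M0" "rotation_angle M1 \<noteq> 0"
    using eventually_happens'[OF trivial_limit_at_top_linorder] by blast
  have "((\<lambda>M. M powr (-(\<gamma> + 2)) * (M powr (\<gamma> + 2) * rotation_angle M)) \<longlongrightarrow> 0 * (a * \<gamma> * pi)) at_top"
    by (intro tendsto_mult rotation_angle_asymp tendsto_neg_powr filterlim_ident) (use \<gamma> in auto)
  then have "(rotation_angle \<longlongrightarrow> 0 * (a * \<gamma> * pi)) at_top"
  proof (rule Lim_transform_eventually)
    show "\<forall>\<^sub>F M in at_top. M powr (-(\<gamma> + 2)) * (M powr (\<gamma> + 2) * rotation_angle M) = rotation_angle M"
      using eventually_gt_at_top[of 0] by eventually_elim (simp flip: mult.assoc powr_add)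
  qed
  then have lim: "((\<lambda>M. \<bar>rotation_angle M\<bar>) \<longlongrightarrow> 0) at_top"
    by (intro tendsto_rabs_zero) simp
  have hit: "2 * pi / real n \<in> (\<lambda>M. \<bar>rotation_angle M\<bar>) ` ?S"
    if n: "n > 0" "2 * pi / real n < \<bar>rotation_angle M1\<bar>" for n :: nat
  proof -
    have "\<forall>\<^sub>F M in at_top. \<bar>rotation_angle M\<bar> < 2 * pi / real n \<and> M \<ge> M1"
      using n by (intro eventually_conj order_tendstoD(2)[OF lim] eventually_ge_at_top) simp
    then obtain M2 where M2: "\<bar>rotation_angle M2\<bar> < 2 * pi / real n" "M2 \<ge> M1"
      using eventually_happens'[OF trivial_limit_at_top_linorder] by blast
    have "continuous_on {M1..M2} (\<lambda>M. \<bar>rotation_angle M\<bar>)"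
      using M1 by (intro continuous_intros continuous_on_subset[OF continuous_on_rotation_angle]) auto
    then obtain M where M: "M1 \<le> M" "\<bar>rotation_angle M\<bar> = 2 * pi / real n"
      using IVT2'[of "\<lambda>M. \<bar>rotation_angle M\<bar>" M2 "2 * pi / real n" M1] M2 n by auto
    then have "real n * rotation_angle M = 2 * pi \<or> real n * rotation_angle M = - (2 * pi)"
      using n by (auto simp: abs_if field_simps split: if_splits)
    then have "cis (real n * rotation_angle M) = 1"
      by (auto simp: complex_eq_iff)
    then have "M \<in> ?S" using M M1 n by auto
    with M show ?thesis by force
  qed
  obtain N :: nat where N: "N > 0" "2 * pi / real N < \<bar>rotation_angle M1\<bar>"
  proof -
    obtain N :: nat where N: "2 * pi / \<bar>rotation_angle M1\<bar> < real N" using reals_Archimedean2 by blast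
    moreover have "0 < 2 * pi / \<bar>rotation_angle M1\<bar>" using M1 by simp
    ultimately have "0 < N" by (metis less_trans of_nat_0_less_iff)
    with N M1 that show ?thesis by (simp add: field_simps)
  qed
  have "(\<lambda>n. 2 * pi / real n) ` {N..} \<subseteq> (\<lambda>M. \<bar>rotation_angle M\<bar>) ` ?S"
  proof clarify
    fix n assume "n \<ge> N"
    then have "2 * pi / real n \<le> 2 * pi / real N" using N by (intro divide_left_mono) auto
    then show "2 * pi / real n \<in> (\<lambda>M. \<bar>rotation_angle M\<bar>) ` ?S" using N \<open>n \<ge> N\<close> by (intro hit) auto
  qed
  moreover have "inj_on (\<lambda>n. 2 * pi / real n) {N..}"
    using N by (auto simp: inj_on_def field_simps)
  then have "infinite ((\<lambda>n. 2 * pi / real n) ` {N..})"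
    using finite_imageD infinite_Ici by blast
  ultimately show ?thesis using finite_subset finite_imageI by blast
qed

end

subsection \<open>The given curvature function\<close>

text \<open>On the positive real axis \<open>h\<close> agrees with \<open>H\<close>, so its
  derivatives are those of \<open>H\<close> in direction 1.\<close>

lemma C2_plane_radial_profile:
  assumes "C2_plane H" and radial: "\<And>p. H p = h (cmod p)"
  obtains h1 h2 where "\<And>s. s > 0 \<Longrightarrow> (h has_real_derivative h1 s) (at s)"
    and "\<And>s. s > 0 \<Longrightarrow> (h1 has_real_derivative h2 s) (at s)"
    and "continuous_on {0<..} h2"
proof -
  obtain H1 :: "complex \<Rightarrow> complex \<Rightarrow>\<^sub>L real" and H2 :: "complex \<Rightarrow> complex \<Rightarrow>\<^sub>L (complex \<Rightarrow>\<^sub>L real)"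
    where H1: "\<And>p. (H has_derivative blinfun_apply (H1 p)) (at p)"
      and H2: "\<And>p. (H1 has_derivative blinfun_apply (H2 p)) (at p)" and cont: "continuous_on UNIV H2"
    using assms(1) unfolding C2_plane_def by blast
  have of_real: "(complex_of_real has_vector_derivative 1) (at s)" for s
    using has_vector_derivative_of_real[OF DERIV_ident] by simp
  have d1: "((\<lambda>s. H (of_real s)) has_real_derivative H1 (of_real s) 1) (at s)" for s
    using has_derivative_compose[OF of_real[of s, unfolded has_vector_derivative_def] H1]
    by (simp add: has_field_derivative_def blinfun.scaleR_right mult_commute_abs)
  have "((\<lambda>s. H1 (of_real s)) has_vector_derivative H2 (of_real s) 1) (at s)" for s
    using has_derivative_compose[OF of_real[of s, unfolded has_vector_derivative_def] H2]
    by (simp add: has_vector_derivative_def blinfun.scaleR_right)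
  from bounded_linear.has_vector_derivative[OF blinfun.bounded_linear_left this]
  have d2: "((\<lambda>s. H1 (of_real s) 1) has_real_derivative H2 (of_real s) 1 1) (at s)" for s
    unfolding has_real_derivative_iff_has_vector_derivative .
  show ?thesis
  proof
    fix s :: real assume "s > 0"
    show "(h has_real_derivative H1 (of_real s) 1) (at s)"
      \<comment> \<open>\<open>H (of_real s)\<close> is h(|s|), hence the restriction to an open set
        of positive s.\<close>
      by (rule has_field_derivative_transform_within_open[OF d1, of "{0<..}"])
         (use \<open>s > 0\<close> in \<open>auto simp: radial\<close>)
    show "((\<lambda>s. H1 (of_real s) 1) has_real_derivative H2 (of_real s) 1 1) (at s)" by (rule d2)
  next
    show "continuous_on {0<..} (\<lambda>s::real. H2 (of_real s) 1 1)"
      by (intro continuous_intros continuous_on_compose2[OF cont]) auto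
  qed
qed

text \<open>For \<beta> = 0 the constant B merges into the leading coefficient A + B, nonzero by
  assumption. For 0 < \<beta> \<le> 1 it gives the second term. For \<beta> > 1 the whole
  correction, being bounded times s^(-\<gamma>-\<beta>), is absorbed in the remainder.\<close>

lemma two_term_expansion:
  fixes h ht :: "real \<Rightarrow> real"
  assumes "A \<noteq> 0" and beta: "\<beta> \<ge> 0"
    and h_exp: "\<exists>s0. \<forall>s\<ge>s0. h s = 1 + A / s powr \<gamma> + ht s / s powr (\<gamma> + \<beta>)"
    and ht_big: "\<beta> > 1 \<Longrightarrow> bounded (ht ` {0<..})"
    and ht_mid: "0 < \<beta> \<Longrightarrow> \<beta> \<le> 1 \<Longrightarrow>
                   \<exists>B. (\<lambda>s. ht s - B) \<in> o[at_top](\<lambda>s. s powr (\<beta> - 1))"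
    and ht_zero: "\<beta> = 0 \<Longrightarrow>
                   \<exists>B. B \<noteq> - A \<and> (\<lambda>s. ht s - B) \<in> o[at_top](\<lambda>s. s powr (-1))"
  obtains a b \<beta>' where "a \<noteq> 0" "\<beta>' > 0"
    "((\<lambda>s. s powr (\<gamma> + 1) * (h s - 1 - a * s powr (-\<gamma>) - b * s powr (-(\<gamma> + \<beta>'))))
      \<longlongrightarrow> 0) at_top"
proof -
  obtain s0 where s0: "\<And>s. s \<ge> s0 \<Longrightarrow> h s = 1 + A / s powr \<gamma> + ht s / s powr (\<gamma> + \<beta>)"
    using h_exp by blast
  have ev: "\<forall>\<^sub>F s in at_top. s > 0 \<and> h s = 1 + A * s powr (-\<gamma>) + ht s * s powr (-(\<gamma> + \<beta>))"
    using eventually_gt_at_top[of 0] eventually_ge_at_top[of s0]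
    by eventually_elim (use s0 in \<open>auto simp: powr_minus_divide simp del: minus_add_distrib\<close>)
  \<comment> \<open>Once the explicit terms match, the remainder times s^(\<gamma>+1) is
    s^(1-\<beta>) (ht(s) - B).\<close>
  have reduce: "((\<lambda>s. s powr (\<gamma> + 1) * (h s - 1 - a * s powr (-\<gamma>) - b * s powr (-(\<gamma> + \<beta>'))))
      \<longlongrightarrow> 0) at_top"
    if lim: "((\<lambda>s. s powr (1 - \<beta>) * (ht s - B)) \<longlongrightarrow> 0) at_top"
      and eq: "\<And>s. a * s powr (-\<gamma>) + b * s powr (-(\<gamma> + \<beta>')) = A * s powr (-\<gamma>) + B * s powr (-(\<gamma> + \<beta>))"
    for a b \<beta>' B
  proof (rule Lim_transform_eventually[OF lim])
    show "\<forall>\<^sub>F s in at_top. s powr (1 - \<beta>) * (ht s - B)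
        = s powr (\<gamma> + 1) * (h s - 1 - a * s powr (-\<gamma>) - b * s powr (-(\<gamma> + \<beta>')))"
      using ev
    proof eventually_elim
      case (elim s)
      have "h s - 1 - a * s powr (-\<gamma>) - b * s powr (-(\<gamma> + \<beta>')) = s powr (-(\<gamma> + \<beta>)) * (ht s - B)"
        using eq[of s] elim by (simp add: algebra_simps)
      then show ?case by (simp only:) (simp flip: mult.assoc powr_add)
    qed
  qed
  have small: "((\<lambda>s. s powr (1 - \<beta>) * (ht s - B)) \<longlongrightarrow> 0) at_top"
    if "(\<lambda>s. ht s - B) \<in> o[at_top](\<lambda>s. s powr (\<beta> - 1))" for B
  proof -
    have "((\<lambda>s. (ht s - B) / s powr (\<beta> - 1)) \<longlongrightarrow> 0) at_top"
      using that by (rule smalloD_tendsto)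
    moreover have "(ht s - B) / s powr (\<beta> - 1) = s powr (1 - \<beta>) * (ht s - B)" for s
      using powr_minus_divide[of s "\<beta> - 1"] by simp
    ultimately show ?thesis by simp
  qed
  consider "\<beta> = 0" | "0 < \<beta>" "\<beta> \<le> 1" | "\<beta> > 1" using beta by linarith
  then show ?thesis
  proof cases
    case 1
    then obtain B where B: "B \<noteq> -A" "(\<lambda>s. ht s - B) \<in> o[at_top](\<lambda>s. s powr (\<beta> - 1))"
      using ht_zero by auto
    show ?thesis
      \<comment> \<open>The second coefficient is 0, so the exponent 1 is just some positive
        number.\<close>
      by (rule that[of "A + B" 1, OF _ _ reduce[OF small[OF B(2)], of "A + B" 0]])
         (use B 1 in \<open>auto simp: algebra_simps\<close>)
  next
    case 2
    then obtain B where B: "(\<lambda>s. ht s - B) \<in> o[at_top](\<lambda>s. s powr (\<beta> - 1))"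
      using ht_mid by auto
    show ?thesis
      by (rule that[of A \<beta>, OF _ _ reduce[OF small[OF B], of A B]]) (use assms 2 in auto)
  next
    case 3
    then obtain K where K: "\<And>s. s > 0 \<Longrightarrow> \<bar>ht s\<bar> \<le> K"
      using ht_big by (auto simp: bounded_iff)
    have "((\<lambda>s. s powr (1 - \<beta>) * ht s) \<longlongrightarrow> 0) at_top"
    proof (rule Lim_null_comparison)
      show "\<forall>\<^sub>F s in at_top. norm (s powr (1 - \<beta>) * ht s) \<le> s powr (1 - \<beta>) * K"
        using eventually_gt_at_top[of 0]
        by eventually_elim (auto simp: abs_mult intro!: mult_left_mono K)
      show "((\<lambda>s. s powr (1 - \<beta>) * K) \<longlongrightarrow> 0) at_top"
        by (intro tendsto_mult_left_zero tendsto_neg_powr filterlim_ident) (use 3 in auto)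
    qed
    then show ?thesis
      by (intro that[of A 1, OF _ _ reduce[of 0 A 0]]) (use assms in auto)
  qed
qed

text \<open>Rotations and reparametrizations of one solution are again solutions. Comparing images
  up to rotation keeps such copies from accounting for the infinitude.\<close>

theorem theorem1p1p5:
  fixes H :: "complex \<Rightarrow> real" and h ht :: "real \<Rightarrow> real"
    and A \<gamma> \<beta> :: real
  assumes H_C2: "C2_plane H"
    and H_radial: "\<forall>p. H p = h (cmod p)"
    and A_nz: "A \<noteq> 0" and gamma: "\<gamma> > 1" and beta: "\<beta> \<ge> 0"
    and ht_C2: "C2_pos ht"
    and h_exp: "\<exists>s0. \<forall>s\<ge>s0. h s = 1 + A / s powr \<gamma> + ht s / s powr (\<gamma> + \<beta>)"
    and ht_big: "\<beta> > 1 \<Longrightarrow> bounded (ht ` {0<..})"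
    and ht_mid: "0 < \<beta> \<Longrightarrow> \<beta> \<le> 1 \<Longrightarrow>
                   \<exists>B. (\<lambda>s. ht s - B) \<in> o[at_top](\<lambda>s. s powr (\<beta> - 1))"
    and ht_zero: "\<beta> = 0 \<Longrightarrow>
                   \<exists>B. B \<noteq> - A \<and> (\<lambda>s. ht s - B) \<in> o[at_top](\<lambda>s. s powr (-1))"
    and h2_bound: "\<exists>C>0. \<exists>s1. \<forall>s\<ge>s1.
                     \<bar>deriv (deriv h) s\<bar> \<le> C * s powr (- (\<gamma> + 1 + min 1 \<beta>))"
  shows "\<exists>\<C> :: (real \<Rightarrow> complex) set. infinite \<C> \<and>
           (\<forall>U\<in>\<C>. \<forall>\<alpha>. 0 < \<alpha> \<and> \<alpha> < 1 \<longrightarrow> closed_curve_C2a_curv \<alpha> H U) \<and>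
           (\<forall>U\<in>\<C>. \<forall>V\<in>\<C>. U \<noteq> V \<longrightarrow>
              (\<forall>w. cmod w = 1 \<longrightarrow> (\<lambda>z. w * z) ` range U \<noteq> range V))"
proof -
  have radial: "\<And>p. H p = h (cmod p)" using H_radial by blast
  obtain h1 h2 where dh: "\<And>s. s > 0 \<Longrightarrow> (h has_real_derivative h1 s) (at s)"
    and dh1: "\<And>s. s > 0 \<Longrightarrow> (h1 has_real_derivative h2 s) (at s)"
    and cont_h2: "continuous_on {0<..} h2"
    using C2_plane_radial_profile[OF H_C2 radial] by blast
  obtain a b \<beta>' where a: "a \<noteq> 0" and \<beta>': "\<beta>' > 0" and expansion:
    "((\<lambda>s. s powr (\<gamma> + 1) * (h s - 1 - a * s powr (-\<gamma>) - b * s powr (-(\<gamma> + \<beta>'))))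
      \<longlongrightarrow> 0) at_top"
    by (rule two_term_expansion[OF A_nz beta h_exp ht_big ht_mid ht_zero])
  have "(h \<longlongrightarrow> 1) at_top"
    using gamma by (intro expansion_imp_tendsto_1[OF _ \<beta>' expansion]) simp
  then have "\<forall>\<^sub>F s in at_top. h s > 1/2"
    by (rule order_tendstoD(1)) simp
  then have "\<forall>\<^sub>F s in at_top. s * h s \<ge> 3"
    using eventually_ge_at_top[of 6]
  proof eventually_elim
    case (elim s)
    then have "6 * (1/2) \<le> s * h s" by (intro mult_mono) auto
    then show ?case by simp
  qed
  then obtain R' where R': "\<And>s. s \<ge> R' \<Longrightarrow> s * h s \<ge> 3"
    by (auto simp: eventually_at_top_linorder)
  define R where "R = max R' 1"
  have "\<exists>G. \<forall>s::real. 0 < ereal s \<longrightarrow> ereal s < \<infinity> \<longrightarrow> (G has_vector_derivative s * h s) (at s)"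
    by (intro einterval_antiderivative) (auto intro!: continuous_intros DERIV_isCont[OF dh])
  then obtain G where G: "\<And>s. s > 0 \<Longrightarrow> (G has_real_derivative s * h s) (at s)"
    by (auto simp: has_real_derivative_iff_has_vector_derivative)
  define K where "K = G R + 2 * R"
  \<comment> \<open>\<open>M0\<close> is at least 1 and at least 2K, so its square is at least
    2K.\<close>
  define M0 where "M0 = 1 + 2 * \<bar>K\<bar>"
  have "M0 \<le> M0\<^sup>2" by (intro self_le_power) (auto simp: M0_def)
  then have "K \<le> M0\<^sup>2 / 2" unfolding M0_def by linarith
  then have M0: "G R + 2 * R \<le> M0\<^sup>2 / 2" by (simp add: K_def)
  have "R > 0" "\<And>s. s \<ge> R \<Longrightarrow> s * h s \<ge> 3" "M0 > 0"
    using R' by (auto simp: R_def M0_def)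
  interpret radial_curvature_expansion h h1 h2 G R M0 a b \<gamma> \<beta>'
    by unfold_locales fact+
  define S where "S = {M. M \<ge> M0 \<and> (\<exists>n>0. cis (real n * rotation_angle M) = 1)}"
  have congruent: "M = N" if "M \<in> S" "N \<in> S" "cmod w = 1"
    "(\<lambda>z. w * z) ` range (level_curve M) = range (level_curve N)" for M N w
    using that level_curve_congruent_imp_eq[of M N w] by (simp add: S_def)
  \<comment> \<open>Equal curves are congruent by the trivial rotation w = 1.\<close>
  have "inj_on level_curve S"
    by (rule inj_onI, rule congruent[of _ _ 1]) simp_all
  then have "infinite (level_curve ` S)"
    using infinite_closing_levels[OF a] finite_imageD unfolding S_def by blast
  moreover have "closed_curve_C2a_curv \<alpha> H (level_curve M)" if M: "M \<in> S" and \<alpha>: "0 < \<alpha>" "\<alpha> < 1" for M \<alpha>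
  proof -
    obtain n :: nat where "n > 0" "cis (real n * rotation_angle M) = 1" "M \<ge> M0"
      using M by (auto simp: S_def)
    then show ?thesis using \<alpha> by (intro level_curve_closed[OF _ _ _ radial])
  qed
  ultimately show ?thesis
    using congruent by (intro exI[of _ "level_curve ` S"]) blast
qed

end
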